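(* Let $d\ge1$, $x_0\in\mathbb{R}^d$, and let $c:\mathbb{R}^d\times\mathbb{R}^d\to\mathbb{R}$ be second order complete at infinity at $x_0$ and $C^{1,2}$ at $(x_0,x_0)$. Then $$d+1+\mathbf{1}_{\{d\text{ even}\}}\le N_c(x_0)\le 2^d.$$
   Context: $C^{1,2}$ refers to continuous differentiability once in $x$ and twice in $y$, mixed derivatives included. $H_c(x_0):=\big(c_{x_i,y^2}(x_0,x_0)[Y^2]\big)_{1\le i\le d}$ where $c_{x_i,y^2}(x_0,x_0)[Y^2]:=\sum_{1\le j,l\le d}\partial^3_{x_i,y_j,y_l}c(x_0,x_0)Y_jY_l$. For $Q_1,\dots,Q_d\in\mathbb{R}[Y_1,\dots,Y_d]$, $Z^1_{\mathbb{R}}(Q_1,\dots,Q_d)$ is the set of real single common zeros: points $y\in\mathbb{R}^d$ with $Q_i(y)=0$ for all $i$ and $\nabla Q_1(y),\dots,\nabla Q_d(y)$ linearly independent. With $\mathbb{R}_n[Y_1,\dots,Y_d]$ the polynomials of degree at most $n$, $$N_c(x_0):=\sup_{P\in\mathbb{R}_1[Y_1,\dots,Y_d]^d}\big|Z^1_{\mathbb{R}}(H_c(x_0)+P)\big|.$$ $c$ is second order complete at infinity at $x_0$ if $c$ is differentiable at $x=x_0$ and twice differentiable at $y=x_0$ (so that $H_c(x_0)$ is defined), and $H_c(x_0)$ is a complete at infinity family of $\mathbb{R}_2[Y_1,\dots,Y_d]$. A family $(P_1,\dots,P_k)$ in $\mathbb{R}[Y_1,\dots,Y_d]$ is complete at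 infinity if for every $1\le i\le k$ and every $Q\in\mathbb{R}[Y_1,\dots,Y_d]$ with $Q\notin\langle P_1^{hom},\dots,P_{i-1}^{hom}\rangle$ one has $QP_i^{hom}\notin\langle P_1^{hom},\dots,P_{i-1}^{hom}\rangle$, where $P^{hom}$ is the sum of the terms of $P$ of degree $\deg P$, $\langle\cdot\rangle$ is the generated ideal and $\langle\emptyset\rangle=\{0\}$. *)

theory Defs
  imports
    "HOL-Analysis.Analysis"
    "HOL-Library.Poly_Mapping"
    "HOL-Library.Extended_Nat"
begin

section \<open>Real polynomials in finitely many variables\<close>

text \<open>
  A monomial is its exponent vector; the ring structure (convolution product) is the one
  of \<^theory>\<open>HOL-Library.Poly_Mapping\<close>. The variables are indexed by a finite type, so that
  the points at which polynomials are evaluated live in \<open>real ^ 'n\<close>.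
\<close>

type_synonym 'n rpoly = "('n \<Rightarrow>\<^sub>0 nat) \<Rightarrow>\<^sub>0 real"

definition Var :: "'n \<Rightarrow> 'n rpoly" where
  "Var i = Poly_Mapping.single (Poly_Mapping.single i 1) 1"

definition Const :: "real \<Rightarrow> 'n rpoly" where
  "Const a = Poly_Mapping.single 0 a"

definition mon_degree :: "('n::finite \<Rightarrow>\<^sub>0 nat) \<Rightarrow> nat" where
  "mon_degree m = (\<Sum>i\<in>UNIV. Poly_Mapping.lookup m i)"

text \<open>The zero polynomial gets degree \<open>0\<close>.\<close>

definition total_degree :: "('n::finite) rpoly \<Rightarrow> nat" where
  "total_degree p = Max (insert 0 (mon_degree ` Poly_Mapping.keys p))"

definition hom_part :: "('n::finite) rpoly \<Rightarrow> 'n rpoly" where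
  "hom_part p = (\<Sum>m | m \<in> Poly_Mapping.keys p \<and> mon_degree m = total_degree p.
     Poly_Mapping.single m (Poly_Mapping.lookup p m))"

definition eval_poly :: "('n::finite) rpoly \<Rightarrow> real ^ 'n \<Rightarrow> real" where
  "eval_poly p y = (\<Sum>m\<in>Poly_Mapping.keys p.
     Poly_Mapping.lookup p m * (\<Prod>i\<in>UNIV. (y $ i) ^ Poly_Mapping.lookup m i))"

text \<open>The ideal generated by \<open>S\<close>, as the submodule of the ring over itself spanned by \<open>S\<close>.\<close>

lemma module_rpoly: "module ((*) :: 'n rpoly \<Rightarrow> 'n rpoly \<Rightarrow> 'n rpoly)"
  by unfold_locales (auto simp: algebra_simps)

definition ideal_gen :: "'n rpoly set \<Rightarrow> 'n rpoly set" where
  "ideal_gen S = module.span (*) S"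

definition complete_at_infinity :: "('k::linorder \<Rightarrow> ('n::finite) rpoly) \<Rightarrow> bool" where
  "complete_at_infinity P \<longleftrightarrow>
     (\<forall>i Q. Q \<notin> ideal_gen ((\<lambda>j. hom_part (P j)) ` {..<i}) \<longrightarrow>
        Q * hom_part (P i) \<notin> ideal_gen ((\<lambda>j. hom_part (P j)) ` {..<i}))"


section \<open>Partial derivatives\<close>

definition dir_deriv :: "('a::real_normed_vector \<Rightarrow> real) \<Rightarrow> 'a \<Rightarrow> 'a \<Rightarrow> real" where
  "dir_deriv f v p = deriv (\<lambda>t. f (p + t *\<^sub>R v)) 0"

definition has_dir_deriv_at :: "('a::real_normed_vector \<Rightarrow> real) \<Rightarrow> 'a \<Rightarrow> 'a \<Rightarrow> bool" where
  "has_dir_deriv_at f v p \<longleftrightarrow> (\<lambda>t. f (p + t *\<^sub>R v)) differentiable (at 0)"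

definition gradient :: "(real ^ 'n \<Rightarrow> real) \<Rightarrow> real ^ 'n \<Rightarrow> real ^ 'n" where
  "gradient f y = (\<chi> j. dir_deriv f (axis j 1) y)"

text \<open>
  For a function of \<open>(x, y)\<close>, the letter \<open>Inl i\<close> stands for the coordinate \<open>x\<^sub>i\<close> and
  \<open>Inr j\<close> for \<open>y\<^sub>j\<close>. The iterated derivative along a word applies the last letter first:
  the word \<open>[Inl i, Inr j, Inr l]\<close> yields the derivative in \<open>x\<^sub>i\<close> of the derivative in \<open>y\<^sub>j\<close>
  of the derivative in \<open>y\<^sub>l\<close>.
\<close>

fun coord_dir :: "'n + 'n \<Rightarrow> (real ^ 'n) \<times> (real ^ 'n)" where
  "coord_dir (Inl i) = (axis i 1, 0)"
| "coord_dir (Inr j) = (0, axis j 1)"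

fun iter_partial ::
  "('n + 'n) list \<Rightarrow> ((real ^ 'n) \<times> (real ^ 'n) \<Rightarrow> real) \<Rightarrow> (real ^ 'n) \<times> (real ^ 'n) \<Rightarrow> real"
where
  "iter_partial [] f = f"
| "iter_partial (e # w) f = dir_deriv (iter_partial w f) (coord_dir e)"

text \<open>Words with at most one \<open>x\<close>-letter and at most two \<open>y\<close>-letters, in any order.\<close>

definition order_1_2 :: "('n + 'n) list \<Rightarrow> bool" where
  "order_1_2 w \<longleftrightarrow> length (filter isl w) \<le> 1 \<and> length (filter (\<lambda>e. \<not> isl e) w) \<le> 2"

text \<open>
  As usual for continuous differentiability at a point, the derivatives are required to
  exist in a neighbourhood of the point and to be continuous at the point. This is implied
  by their being continuous in a neighbourhood.
\<close>

definition C12_at :: "((real ^ 'n) \<times> (real ^ 'n) \<Rightarrow> real) \<Rightarrow> (real ^ 'n) \<times> (real ^ 'n) \<Rightarrow> bool" where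
  "C12_at c p \<longleftrightarrow>
     (\<exists>U. open U \<and> p \<in> U \<and>
        (\<forall>e w. order_1_2 (e # w) \<longrightarrow>
           (\<forall>q\<in>U. has_dir_deriv_at (iter_partial w c) (coord_dir e) q))) \<and>
     (\<forall>w. order_1_2 w \<longrightarrow> isCont (iter_partial w c) p)"

definition twice_differentiable_at :: "(real ^ 'n \<Rightarrow> real) \<Rightarrow> real ^ 'n \<Rightarrow> bool" where
  "twice_differentiable_at f y0 \<longleftrightarrow>
     (\<forall>\<^sub>F y in nhds y0. f differentiable (at y)) \<and> gradient f differentiable (at y0)"

text \<open>
  Differentiability once at \<open>x = x0\<close> and twice at \<open>y = x0\<close>, up to and including the
  existence of the derivative in \<open>x\<close> of the second derivatives in \<open>y\<close>.
\<close>

definition differentiable_1_2_at ::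
  "((real ^ 'n) \<times> (real ^ 'n) \<Rightarrow> real) \<Rightarrow> real ^ 'n \<Rightarrow> bool"
where
  "differentiable_1_2_at c x0 \<longleftrightarrow>
     (\<lambda>x. c (x, x0)) differentiable (at x0) \<and>
     (\<forall>\<^sub>F x in nhds x0. twice_differentiable_at (\<lambda>y. c (x, y)) x0) \<and>
     (\<forall>j l. (\<lambda>x. iter_partial [Inr j, Inr l] c (x, x0)) differentiable (at x0))"


section \<open>Second order completeness at infinity and the zero count\<close>

definition Hc ::
  "((real ^ 'n) \<times> (real ^ 'n) \<Rightarrow> real) \<Rightarrow> real ^ 'n \<Rightarrow> 'n \<Rightarrow> ('n::finite) rpoly"
where
  "Hc c x0 i = (\<Sum>j\<in>UNIV. \<Sum>l\<in>UNIV.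
     Const (iter_partial [Inl i, Inr j, Inr l] c (x0, x0)) * Var j * Var l)"

definition second_order_complete_at_infinity ::
  "((real ^ 'n::{finite, linorder}) \<times> (real ^ 'n::{finite, linorder}) \<Rightarrow> real) \<Rightarrow>
     real ^ 'n::{finite, linorder} \<Rightarrow> bool"
where
  "second_order_complete_at_infinity c x0 \<longleftrightarrow>
     differentiable_1_2_at c x0 \<and> complete_at_infinity (Hc c x0)"

text \<open>
  Linear independence of the family of gradients: \<^const>\<open>independent\<close> is a property of sets,
  so injectivity excludes repeated gradients.
\<close>

definition single_zeros :: "('n \<Rightarrow> ('n::finite) rpoly) \<Rightarrow> (real ^ 'n) set" where
  "single_zeros Q =
     {y. (\<forall>i. eval_poly (Q i) y = 0) \<and>
         inj (\<lambda>i. gradient (eval_poly (Q i)) y) \<and>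
         independent ((\<lambda>i. gradient (eval_poly (Q i)) y) ` UNIV)}"

definition ecard :: "'a set \<Rightarrow> enat" where
  "ecard A = (if finite A then enat (card A) else \<infinity>)"

definition Nc :: "((real ^ 'n) \<times> (real ^ 'n) \<Rightarrow> real) \<Rightarrow> real ^ 'n::finite \<Rightarrow> enat" where
  "Nc c x0 = (SUP P \<in> {P. \<forall>i. total_degree (P i) \<le> 1}. ecard (single_zeros (\<lambda>i. Hc c x0 i + P i)))"

end

theory Submission
  imports Defs "HOL-Analysis.Finite_Function_Topology" "Jordan_Normal_Form.Char_Poly"
begin

text \<open>
  The quadratic forms \<open>q\<^sub>i\<close> in \<open>H\<^sub>c(x\<^sub>0)\<close> form a regular sequence. Hence, for all affine \<open>P\<^sub>i\<close>, the ideal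
  of the \<open>F\<^sub>i = q\<^sub>i + P\<^sub>i\<close> has the same codimension as that of the squares \<open>Y\<^sub>i\<^sup>2\<close>, namely \<open>2\<^sup>d\<close>, and
  evaluation at the real zeros is onto, so that there are at most \<open>2\<^sup>d\<close> of them.

  For the lower bound, affine \<open>P\<^sub>i\<close> are interpolated such that \<open>d + 1\<close> generic points become simple zeros.
  If \<open>d\<close> is even, one more zero comes from parity: by Sard's theorem the constant terms can be
  perturbed so that all real zeros become simple while these \<open>d + 1\<close> survive. The image \<open>K\<close> in the
  quotient algebra of the polynomials vanishing at all real zeros then has even dimension, so the number of
  zeros has the parity of \<open>2\<^sup>d\<close>. Indeed, if \<open>dim K\<close> were odd, the commuting transposed
  multiplication operators would have a common eigenvector on \<open>K\<close>. Its eigenvalues are the coordinates of a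
  real zero, at which the eigenvector induces a nonzero point derivation killing all the \<open>F\<^sub>i\<close>, against simplicity.
\<close>

no_notation vec_index (infixl "$" 100)
hide_const (open) Determinant.det Ring_Hom_Poly.eval_poly Matrix.orthogonal Matrix.mat
hide_fact (open) Ring_Hom_Poly.eval_poly_def Matrix.vec_eq_iff Matrix.orthogonal_def

section \<open>Evaluation and gradients of polynomials\<close>

text \<open>Parity reflects conjugation: once the real zeros are simple, \<open>K\<close> is the
  factor of the quotient algebra carried by the nonreal zeros, and these come in conjugate pairs.
  Complex numbers are avoided by letting odd dimension produce a real eigenvalue. The operators are
  transposed because an eigenvector of the transposes is a functional \<phi> with \<phi>(g f) = g(y)
  \<phi>(f), which detects a point y directly. The obstacle for the codimension is cancellation: an
  ideal element of low degree might need cofactors of high degree. Regularity lowers such cofactors,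
  and the dimensions below each degree bound then obey the same recursion as the count of monomials
  divisible by no Y_i^2. The number d + 1 is the number of coefficients of an affine polynomial.
  Parity adds a zero for even d because d + 1 is then odd while 2^d is even. It counts correctly
  only if every real zero is simple, whereas interpolation controls only the chosen ones; hence the
  perturbation.\<close>

lemma mon_degree_add: "mon_degree (a + b) = mon_degree a + mon_degree b"
  by (simp add: mon_degree_def lookup_add sum.distrib)

lemma mon_degree_0 [simp]: "mon_degree 0 = 0"
  by (simp add: mon_degree_def)

lemma mon_degree_single [simp]: "mon_degree (Poly_Mapping.single i k) = k"
  by (simp add: mon_degree_def lookup_single when_def)

lemma mon_degree_eq_0_iff [simp]: "mon_degree m = 0 \<longleftrightarrow> m = 0"
  by (auto simp: mon_degree_def intro: poly_mapping_eqI)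

lemma finite_mon_degree_less: "finite {m :: 'n::finite \<Rightarrow>\<^sub>0 nat. mon_degree m < n}"
proof (rule finite_imageD[where f = Poly_Mapping.lookup])
  have "Poly_Mapping.lookup ` {m :: 'n \<Rightarrow>\<^sub>0 nat. mon_degree m < n} \<subseteq> UNIV \<rightarrow>\<^sub>E {..<n}"
  proof (rule image_subsetI, rule PiE_I)
    fix m :: "'n \<Rightarrow>\<^sub>0 nat" and i
    assume "m \<in> {m. mon_degree m < n}"
    moreover have "Poly_Mapping.lookup m i \<le> mon_degree m"
      unfolding mon_degree_def by (rule member_le_sum) auto
    ultimately show "Poly_Mapping.lookup m i \<in> {..<n}" by simp
  qed auto
  then show "finite (Poly_Mapping.lookup ` {m :: 'n \<Rightarrow>\<^sub>0 nat. mon_degree m < n})"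
    by (rule finite_subset) (simp add: finite_PiE)
  show "inj_on Poly_Mapping.lookup {m :: 'n \<Rightarrow>\<^sub>0 nat. mon_degree m < n}"
    by (rule inj_onI) (simp add: lookup_inject)
qed

lemma lookup_scaleR [simp]: "Poly_Mapping.lookup (c *\<^sub>R p) m = c *\<^sub>R Poly_Mapping.lookup p m"
proof -
  have "finite {i. c *\<^sub>R Poly_Mapping.lookup p i \<noteq> 0}"
    by (rule finite_subset[OF _ finite_lookup[of p]]) auto
  then show ?thesis
    by (simp add: scaleR_poly_mapping_def)
qed

lemma Const_times_eq_scaleR: "Const c * p = c *\<^sub>R p"
proof (rule poly_mapping_eqI)
  fix m
  have "Const c * p = Poly_Mapping.map ((*) c) p"
    by (simp add: Const_def mult_map_scale_conv_mult)
  then show "Poly_Mapping.lookup (Const c * p) m = Poly_Mapping.lookup (c *\<^sub>R p) m"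
    by (simp add: map.rep_eq when_def)
qed

lemma Const_0 [simp]: "Const 0 = 0"
  by (simp add: Const_def)

lemma Const_1 [simp]: "Const 1 = 1"
  by (simp add: Const_def)

lemma Const_eq_scaleR_1: "Const c = c *\<^sub>R 1"
  using Const_times_eq_scaleR[of c 1] by simp

lemma mult_scaleR_left_rpoly [simp]: "(c *\<^sub>R p) * (q :: 'n rpoly) = c *\<^sub>R (p * q)"
  by (simp add: Const_times_eq_scaleR[symmetric] mult.assoc)

lemma mult_scaleR_right_rpoly [simp]: "(p :: 'n rpoly) * (c *\<^sub>R q) = c *\<^sub>R (p * q)"
  by (metis mult.commute mult_scaleR_left_rpoly)

lemma linear_mult_rpoly: "linear ((*) (p :: 'n rpoly))"
  by (intro linearI) (simp_all add: distrib_left)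

lemma rpoly_as_sum:
  "p = (\<Sum>m\<in>Poly_Mapping.keys p. Poly_Mapping.single m (Poly_Mapping.lookup p m))"
  by (rule poly_mapping_eqI)
    (auto simp: lookup_sum lookup_single when_def not_in_keys_iff_lookup_eq_zero)

lemma single_eq_scaleR: "Poly_Mapping.single m c = c *\<^sub>R Poly_Mapping.single m (1::real)"
  by (rule poly_mapping_eqI) (simp add: lookup_single when_def)

text \<open>Peeling off one variable at a time is the form of induction suited to differentiability,
  point derivations and eigenfunctionals of the multiplication operators, all of which are known on
  constants, sums and products with a variable.\<close>

lemma rpoly_induct [case_names Const add Var]:
  fixes p :: "'n::finite rpoly"
  assumes C: "\<And>c. P (Const c)" and A: "\<And>p q. P p \<Longrightarrow> P q \<Longrightarrow> P (p + q)"
    and V: "\<And>i p. P p \<Longrightarrow> P (Var i * p)"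
  shows "P p"
proof -
  have mon: "P (Poly_Mapping.single m c)" for m c
  proof (induction "mon_degree m" arbitrary: m)
    case 0
    then show ?case using C[of c] by (simp add: Const_def)
  next
    case (Suc k)
    then obtain i where i: "Poly_Mapping.lookup m i > 0"
      by (metis mon_degree_eq_0_iff nat.distinct(1) neq0_conv poly_mapping_eqI lookup_zero)
    define m' where "m' = m - Poly_Mapping.single i 1"
    have m: "m = Poly_Mapping.single i 1 + m'"
      using i by (auto simp: m'_def lookup_add lookup_minus lookup_single when_def intro!: poly_mapping_eqI)
    then have "k = mon_degree m'"
      using Suc(2) by (simp add: mon_degree_add)
    then have "P (Var i * Poly_Mapping.single m' c)"
      using Suc V by blast
    then show ?case
      by (simp add: Var_def mult_single m)
  qed
  have "P (\<Sum>m\<in>A. Poly_Mapping.single m (Poly_Mapping.lookup p m))" if "finite A" for A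
    using that by induction (use C[of 0] A mon in auto)
  then show ?thesis
    using rpoly_as_sum[of p] by (metis finite_keys)
qed

text \<open>Cancellation can shrink the support of a sum or a multiple; over a common finite
  superset of the supports the evaluations compare term by term.\<close>

lemma eval_poly_superset:
  assumes "finite A" "Poly_Mapping.keys p \<subseteq> A"
  shows "eval_poly p y = (\<Sum>m\<in>A. Poly_Mapping.lookup p m * (\<Prod>i\<in>UNIV. (y $ i) ^ Poly_Mapping.lookup m i))"
  unfolding eval_poly_def
  by (rule sum.mono_neutral_left) (use assms in \<open>auto simp: not_in_keys_iff_lookup_eq_zero\<close>)

lemma eval_poly_add [simp]: "eval_poly (p + q) y = eval_poly p y + eval_poly q y"
proof -
  define A where "A = Poly_Mapping.keys p \<union> Poly_Mapping.keys q"
  have "finite A" "Poly_Mapping.keys p \<subseteq> A" "Poly_Mapping.keys q \<subseteq> A" "Poly_Mapping.keys (p + q) \<subseteq> A"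
    using keys_add[of p q] by (auto simp: A_def)
  then show ?thesis
    by (simp add: eval_poly_superset[of A] lookup_add sum.distrib ring_distribs)
qed

lemma eval_poly_scaleR [simp]: "eval_poly (c *\<^sub>R p) y = c * eval_poly p y"
proof -
  have "Poly_Mapping.keys (c *\<^sub>R p) \<subseteq> Poly_Mapping.keys p"
    by (auto simp: in_keys_iff)
  then show ?thesis
    by (simp add: eval_poly_superset[of "Poly_Mapping.keys p"] sum_distrib_left mult.assoc)
qed

lemma linear_eval_poly: "linear (\<lambda>p. eval_poly p y)"
  by (intro linearI) simp_all

lemma eval_poly_0 [simp]: "eval_poly 0 y = 0"
  by (simp add: eval_poly_def)

lemma eval_poly_diff [simp]: "eval_poly (p - q) y = eval_poly p y - eval_poly q y"
  using linear_diff[OF linear_eval_poly] .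

lemma eval_poly_sum [simp]: "eval_poly (\<Sum>i\<in>A. f i) y = (\<Sum>i\<in>A. eval_poly (f i) y)"
  using linear_sum[OF linear_eval_poly] .

lemma eval_poly_single: "eval_poly (Poly_Mapping.single m c) y = c * (\<Prod>i\<in>UNIV. (y $ i) ^ Poly_Mapping.lookup m i)"
  by (simp add: eval_poly_superset[of "{m}"])

lemma eval_poly_Const [simp]: "eval_poly (Const c) y = c"
  by (simp add: Const_def eval_poly_single)

lemma eval_poly_1 [simp]: "eval_poly 1 y = 1"
  using eval_poly_Const[of 1] by simp

lemma eval_poly_single_mult:
  "eval_poly (Poly_Mapping.single m c * q) y = eval_poly (Poly_Mapping.single m c) y * eval_poly q y"
proof -
  have "eval_poly (Poly_Mapping.single m c * (\<Sum>k\<in>A. Poly_Mapping.single k (f k))) y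
      = eval_poly (Poly_Mapping.single m c) y * eval_poly (\<Sum>k\<in>A. Poly_Mapping.single k (f k)) y" for A f
    by (simp add: sum_distrib_left mult_single eval_poly_single lookup_add power_add prod.distrib mult_ac)
  from this[of "Poly_Mapping.lookup q" "Poly_Mapping.keys q"] show ?thesis
    using rpoly_as_sum[of q] by metis
qed

lemma eval_poly_mult [simp]: "eval_poly (p * q) y = eval_poly p y * eval_poly q y"
proof -
  have "eval_poly ((\<Sum>k\<in>A. Poly_Mapping.single k (f k)) * q) y
      = eval_poly (\<Sum>k\<in>A. Poly_Mapping.single k (f k)) y * eval_poly q y" for A f
    by (simp add: sum_distrib_right eval_poly_single_mult)
  from this[of "Poly_Mapping.lookup p" "Poly_Mapping.keys p"] show ?thesis
    using rpoly_as_sum[of p] by metis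
qed

lemma eval_poly_Var [simp]: "eval_poly (Var i) y = y $ i"
proof -
  have "(\<Prod>j\<in>UNIV. (y $ j) ^ (1 when i = j)) = (\<Prod>j\<in>UNIV. if j = i then y $ j else 1)"
    by (rule prod.cong) (auto simp: when_def)
  then show ?thesis
    by (simp add: Var_def eval_poly_single lookup_single)
qed

section \<open>Differentiability and gradients of polynomial functions\<close>

lemma eval_poly_differentiable: "eval_poly p differentiable (at y)"
proof (induction p rule: rpoly_induct)
  case (Const c)
  then show ?case by (simp add: eval_poly_Const[abs_def])
next
  case (add p q)
  then show ?case by (simp add: eval_poly_add[abs_def])
next
  case (Var i p)
  have "(\<lambda>y. y $ i) differentiable (at y)"
    by (simp add: bounded_linear_imp_differentiable bounded_linear_vec_nth)
  with Var show ?case by (simp add: eval_poly_mult[abs_def])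
qed

lemma dir_deriv_eq:
  assumes "(f has_derivative f') (at y)"
  shows "dir_deriv f v y = f' v"
proof -
  have "((\<lambda>t. y + t *\<^sub>R v) has_derivative (\<lambda>t. t *\<^sub>R v)) (at 0)"
    by (auto intro!: derivative_eq_intros)
  then have "((\<lambda>t. f (y + t *\<^sub>R v)) has_derivative (\<lambda>t. f' (t *\<^sub>R v))) (at 0)"
    using has_derivative_compose[of "\<lambda>t. y + t *\<^sub>R v" _ 0 UNIV f f'] assms by simp
  then have "((\<lambda>t. f (y + t *\<^sub>R v)) has_real_derivative f' v) (at 0)"
    by (rule has_derivative_imp_has_field_derivative)
      (simp add: linear_scale[OF has_derivative_linear[OF assms]])
  then show ?thesis
    by (simp add: dir_deriv_def DERIV_imp_deriv)
qed

text \<open>Derivatives along the axes do not by themselves give a total derivative; with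
  differentiability assumed, expanding the increment in the standard basis identifies it.\<close>

lemma has_derivative_gradient:
  assumes "f differentiable (at y)"
  shows "(f has_derivative (\<lambda>h. gradient f y \<bullet> h)) (at y)"
proof -
  obtain f' where f': "(f has_derivative f') (at y)"
    using assms by (auto simp: differentiable_def)
  then interpret f': linear f' by (rule has_derivative_linear)
  have "f' h = gradient f y \<bullet> h" for h
  proof -
    have "f' h = f' (\<Sum>i\<in>UNIV. (h $ i) *\<^sub>R axis i 1)"
      using basis_expansion[of h] by (simp add: scalar_mult_eq_scaleR)
    also have "\<dots> = (\<Sum>i\<in>UNIV. h $ i * f' (axis i 1))"
      by (simp add: f'.sum f'.scale)
    also have "\<dots> = gradient f y \<bullet> h"
      by (simp add: inner_vec_def gradient_def dir_deriv_eq[OF f'] mult.commute)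
    finally show ?thesis .
  qed
  with f' show ?thesis by (simp add: has_derivative_eq_rhs ext)
qed

lemma gradient_eqI:
  assumes "(f has_derivative (\<lambda>h. g \<bullet> h)) (at y)"
  shows "gradient f y = g"
  by (simp add: gradient_def dir_deriv_eq[OF assms] vec_eq_iff inner_axis)

lemmas has_derivative_eval_poly = has_derivative_gradient[OF eval_poly_differentiable]

lemma gradient_eval_Const [simp]: "gradient (eval_poly (Const c)) y = 0"
  by (rule gradient_eqI) (simp add: eval_poly_Const[abs_def])

lemma gradient_eval_Var [simp]: "gradient (eval_poly (Var i)) y = axis i 1"
  by (rule gradient_eqI)
    (simp add: eval_poly_Var[abs_def] inner_axis' bounded_linear_imp_has_derivative bounded_linear_vec_nth)

lemma gradient_eval_add [simp]:
  "gradient (eval_poly (p + q)) y = gradient (eval_poly p) y + gradient (eval_poly q) y"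
  by (rule gradient_eqI)
    (auto simp: eval_poly_add[abs_def] inner_add_left intro!: derivative_eq_intros has_derivative_eval_poly)

lemma gradient_eval_mult [simp]:
  "gradient (eval_poly (p * q)) y
     = eval_poly p y *\<^sub>R gradient (eval_poly q) y + eval_poly q y *\<^sub>R gradient (eval_poly p) y"
  by (rule gradient_eqI)
    (auto simp: eval_poly_mult[abs_def] inner_add_left mult.commute intro!: derivative_eq_intros has_derivative_eval_poly)

section \<open>Finite-dimensional subspaces of arbitrary real vector spaces\<close>

text \<open>If \<open>a\<close> in \<open>C\<close> equals x + y with x in the span of the rest of
  \<open>C\<close> and y in \<open>span E\<close>, then y lies in both spans, so y = 0 and
  \<open>C\<close> would be dependent.\<close>

lemma independent_UnI:
  assumes C: "independent C" and E: "independent E" and disj: "span C \<inter> span E \<subseteq> {0}"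
  shows "independent (C \<union> E)"
proof -
  have key: "a \<notin> span ((C \<union> E) - {a})"
    if "independent C" "span C \<inter> span E \<subseteq> {0}" "a \<in> C" for a and C E :: "'a set"
  proof
    assume a: "a \<in> span ((C \<union> E) - {a})"
    have "a \<noteq> 0" using that(1,3) dependent_zero[of C] by metis
    moreover have "a \<in> span C" using that(3) by (rule span_base)
    ultimately have "a \<notin> E" using that(2) span_base[of a E] by (metis IntI singletonD subsetD)
    then have "(C \<union> E) - {a} = (C - {a}) \<union> E" by auto
    then obtain x y where xy: "a = x + y" "x \<in> span (C - {a})" "y \<in> span E"
      using a by (auto simp: span_Un)
    have "x \<in> span C" using xy(2) span_mono[of "C - {a}" C] by (metis Diff_subset subsetD)
    then have "y \<in> span C" using xy(1) that(3) by (metis add_diff_cancel_left' span_base span_diff)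
    then have "y = 0" using xy(3) that(2) by (metis IntI singletonD subsetD)
    then have "a \<in> span (C - {a})" using xy(1,2) by simp
    then show False using that(1,3) dependent_def by metis
  qed
  have "a \<notin> span ((C \<union> E) - {a})" if "a \<in> C \<union> E" for a
  proof (cases "a \<in> C")
    case True
    then show ?thesis using key[OF C disj] by simp
  next
    case False
    moreover have "span E \<inter> span C \<subseteq> {0}" using disj by (simp add: Int_commute)
    ultimately show ?thesis using key[OF E, of C a] that by (simp add: Un_commute)
  qed
  then show ?thesis unfolding dependent_def by blast
qed

text \<open>The coordinates of a common element with respect to \<open>D\<close> are supported both
  on \<open>A\<close> and on \<open>B\<close>, hence all vanish.\<close>

lemma span_Int_span_disjoint:
  assumes D: "independent D" and A: "A \<subseteq> D" and B: "B \<subseteq> D" and AB: "A \<inter> B = {}"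
  shows "span A \<inter> span B = {0}"
proof -
  have "x = 0" if x: "x \<in> span A" "x \<in> span B" for x
  proof -
    have "representation D x = representation A x" "representation D x = representation B x"
      using real_vector.representation_extend[OF D] x A B by metis+
    moreover have "representation A x v = 0 \<or> representation B x v = 0" for v
      using AB representation_ne_zero by blast
    ultimately have "representation D x v = 0" for v by metis
    moreover have "x \<in> span D" using x A span_mono by blast
    ultimately show "x = 0"
      using real_vector.sum_nonzero_representation_eq[OF D, of x] by simp
  qed
  then show ?thesis by (auto simp: span_zero)
qed

text \<open>A basis \<open>B\<close> of the intersection extends to bases \<open>C\<close> and
  \<open>D\<close> of the two summands, and \<open>C\<close> together with \<open>D - B\<close> is a
  basis of the sum. The polynomial ring being infinite-dimensional, the finite spanning set
  \<open>A\<close> is what keeps these bases finite.\<close>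

lemma dim_sum_Int_finite:
  fixes S T :: "'a::real_vector set"
  assumes S: "subspace S" and T: "subspace T"
    and fin: "finite A" "S \<subseteq> span A" "T \<subseteq> span A"
  shows "dim {x + y |x y. x \<in> S \<and> y \<in> T} + dim (S \<inter> T) = dim S + dim T"
proof -
  obtain B where B: "B \<subseteq> S \<inter> T" "independent B" "S \<inter> T \<subseteq> span B"
    by (rule maximal_independent_subset)
  obtain C where C: "B \<subseteq> C" "C \<subseteq> S" "independent C" "S \<subseteq> span C"
    using maximal_independent_subset_extend[of B S] B by auto
  obtain D where D: "B \<subseteq> D" "D \<subseteq> T" "independent D" "T \<subseteq> span D"
    using maximal_independent_subset_extend[of B T] B by auto
  have finC: "finite C" and finD: "finite D"
    using independent_span_bound[OF fin(1) C(3)] independent_span_bound[OF fin(1) D(3)] C(2) D(2) fin(2,3)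
    by (metis order_trans)+
  have spanC: "span C = S"
    by (rule antisym[OF span_minimal[OF C(2) S] C(4)])
  have spanD: "span D = T"
    by (rule antisym[OF span_minimal[OF D(2) T] D(4)])
  have spanB: "span B = S \<inter> T"
    by (rule antisym[OF span_minimal[OF B(1) subspace_inter[OF S T]] B(3)])
  \<comment> \<open>An element of both spans lies in \<open>S \<inter> T = span B\<close>, so
    independence of \<open>D\<close> applies.\<close>
  have disj: "span C \<inter> span (D - B) \<subseteq> {0}"
  proof -
    have "span C \<inter> span (D - B) \<subseteq> span B \<inter> span (D - B)"
      using spanB spanC spanD span_mono[of "D - B" D] by auto
    also have "\<dots> = {0}" by (rule span_Int_span_disjoint[OF D(3)]) (use D in auto)
    finally show ?thesis .
  qed
  have ind: "independent (C \<union> (D - B))"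
    by (rule independent_UnI) (use C D disj independent_mono[of D "D - B"] in auto)
  have CD: "C \<inter> (D - B) = {}"
  proof -
    have "x \<in> span B" if "x \<in> C" "x \<in> D" for x using that C D spanB by auto
    moreover have "x \<notin> span B" if "x \<in> D" "x \<notin> B" for x
      using that D(3) span_mono[of B "D - {x}"] D(1) unfolding dependent_def by blast
    ultimately show ?thesis by blast
  qed
  have "span (C \<union> (D - B)) = {x + y |x y. x \<in> S \<and> y \<in> T}"
  proof -
    have "C \<union> (D - B) = C \<union> D" using C(1) by blast
    then show ?thesis by (simp add: span_Un spanC spanD)
  qed
  then have "dim {x + y |x y. x \<in> S \<and> y \<in> T} = card C + card (D - B)"
    using ind CD finC finD by (metis card_Un_disjoint dim_span_eq_card_independent finite_Diff)
  moreover have "dim (S \<inter> T) = card B" "dim S = card C" "dim T = card D"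
    using dim_span_eq_card_independent B C D spanB spanC spanD by metis+
  moreover have "card D = card B + card (D - B)"
    using D finD by (metis card_Diff_subset card_mono finite_subset le_add_diff_inverse)
  ultimately show ?thesis by simp
qed

lemma dim_image_inj_finite:
  fixes f :: "'a::real_vector \<Rightarrow> 'b::real_vector"
  assumes f: "linear f" and inj: "inj f"
  shows "dim (f ` S) = dim S"
proof -
  obtain B where B: "B \<subseteq> S" "independent B" "S \<subseteq> span B" "card B = dim S"
    by (rule basis_exists)
  have "independent (f ` B)"
    using linear_independent_injective_image[OF f B(2)] inj by (simp add: inj_on_subset)
  moreover have "f ` S \<subseteq> span (f ` B)"
    using B(3) by (simp add: linear_span_image[OF f] image_mono)
  ultimately show ?thesis
    using dim_unique[of "f ` B" "f ` S" "card B"] B inj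
    by (metis card_image image_mono inj_on_subset top_greatest)
qed

lemma subspace_dim_equal_finite:
  assumes fin: "finite A" "T \<subseteq> span A" and S: "subspace S" and sub: "S \<subseteq> T" and dims: "dim T \<le> dim S"
  shows "S = T"
proof -
  obtain B where B: "B \<subseteq> S" "independent B" "S \<subseteq> span B" "card B = dim S"
    by (rule basis_exists)
  have "B \<subseteq> T" using B(1) sub by blast
  then obtain C where C: "B \<subseteq> C" "C \<subseteq> T" "independent C" "T \<subseteq> span C"
    by (rule maximal_independent_subset_extend[OF _ B(2)])
  have "finite C" using independent_span_bound[OF fin(1) C(3)] C(2) fin(2) by (metis order_trans)
  moreover have "card C = dim T" using basis_card_eq_dim C by blast
  ultimately have "B = C" using C(1) B(4) dims card_seteq by metis
  then show ?thesis using C B S sub by (metis order_antisym span_minimal)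
qed

section \<open>The degree filtration\<close>

text \<open>A strict bound lets the filtration start with the zero space at \<open>n = 0\<close>, so
  that the zero polynomial needs no degree of its own and recursions can run down to the
  bottom.\<close>

definition deg_less :: "nat \<Rightarrow> 'n::finite rpoly set" where
  "deg_less n = {p. \<forall>m\<in>Poly_Mapping.keys p. mon_degree m < n}"

lemma deg_less_lookup: "p \<in> deg_less n \<longleftrightarrow> (\<forall>m. n \<le> mon_degree m \<longrightarrow> Poly_Mapping.lookup p m = 0)"
  unfolding deg_less_def mem_Collect_eq Ball_def in_keys_iff by (metis not_le)

lemma subspace_deg_less: "subspace (deg_less n)"
  by (auto simp: subspace_def deg_less_lookup lookup_add)

lemma deg_less_0 [simp]: "deg_less 0 = {0}"
  by (auto simp: deg_less_lookup intro: poly_mapping_eqI)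

lemma deg_less_mono: "m \<le> n \<Longrightarrow> deg_less m \<subseteq> deg_less n"
  by (auto simp: deg_less_def)

lemma in_deg_less: "\<exists>n. p \<in> deg_less n"
proof -
  have "finite (mon_degree ` Poly_Mapping.keys p)" by simp
  then obtain n where "\<forall>k \<in> mon_degree ` Poly_Mapping.keys p. k < n"
    using finite_nat_set_iff_bounded by blast
  then show ?thesis by (auto simp: deg_less_def)
qed

lemma deg_less_mult:
  assumes "p \<in> deg_less a" "q \<in> deg_less (Suc b)"
  shows "p * q \<in> deg_less (a + b)"
  using assms keys_mult[of p q] by (fastforce simp: deg_less_def mon_degree_add)

text \<open>The product bound for a cofactor whose degree bound is a truncated predecessor: for
  \<open>n = 0\<close> the cofactor is zero.\<close>

lemma deg_less_mult_pred:
  assumes "p \<in> deg_less (n - 1)" "q \<in> deg_less (Suc (Suc b))"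
  shows "p * q \<in> deg_less (n + b)"
proof (cases n)
  case 0
  then show ?thesis using assms by (simp add: subspace_0[OF subspace_deg_less])
next
  case (Suc m)
  then show ?thesis using deg_less_mult[OF assms] by simp
qed

lemma deg_less_eq_span:
  "deg_less n = span ((\<lambda>m. Poly_Mapping.single m 1) ` {m. mon_degree m < n})"
proof (intro antisym subsetI)
  fix p :: "'a rpoly" assume p: "p \<in> deg_less n"
  have "(\<Sum>m\<in>Poly_Mapping.keys p. Poly_Mapping.single m (Poly_Mapping.lookup p m))
      \<in> span ((\<lambda>m. Poly_Mapping.single m 1) ` {m. mon_degree m < n})"
    by (intro span_sum, subst single_eq_scaleR, intro span_scale span_base)
      (use p in \<open>auto simp: deg_less_def\<close>)
  then show "p \<in> span ((\<lambda>m. Poly_Mapping.single m 1) ` {m. mon_degree m < n})"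
    using rpoly_as_sum[of p] by simp
next
  fix p :: "'a rpoly" assume "p \<in> span ((\<lambda>m. Poly_Mapping.single m 1) ` {m. mon_degree m < n})"
  moreover have "span ((\<lambda>m. Poly_Mapping.single m 1) ` {m. mon_degree m < n}) \<subseteq> (deg_less n :: 'a rpoly set)"
    by (rule span_minimal[OF _ subspace_deg_less]) (auto simp: deg_less_def)
  ultimately show "p \<in> deg_less n" by blast
qed

lemma independent_monomials: "independent ((\<lambda>m. Poly_Mapping.single m (1::real)) ` M)"
proof -
  have "Poly_Mapping.single m (1::real) \<notin> span ((\<lambda>m. Poly_Mapping.single m 1) ` M - {Poly_Mapping.single m 1})" for m
  proof
    assume *: "Poly_Mapping.single m (1::real) \<in> span ((\<lambda>m. Poly_Mapping.single m 1) ` M - {Poly_Mapping.single m 1})"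
    \<comment> \<open>Reading off the coefficient at \<open>m\<close> is a linear functional that
      kills every other monomial.\<close>
    have "subspace {p :: _ \<Rightarrow>\<^sub>0 real. Poly_Mapping.lookup p m = 0}"
      by (auto simp: subspace_def lookup_add)
    then have "span ((\<lambda>m. Poly_Mapping.single m (1::real)) ` M - {Poly_Mapping.single m 1}) \<subseteq> {p. Poly_Mapping.lookup p m = 0}"
      by (intro span_minimal) (auto simp: lookup_single when_def)
    with * show False by auto
  qed
  then show ?thesis unfolding dependent_def by blast
qed

lemma dim_deg_less: "dim (deg_less n :: 'n::finite rpoly set) = card {m :: 'n \<Rightarrow>\<^sub>0 nat. mon_degree m < n}"
proof -
  have "inj (\<lambda>m :: 'n \<Rightarrow>\<^sub>0 nat. Poly_Mapping.single m (1::real))"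
    by (rule injI) (metis keys_single singleton_inject zero_neq_one)
  then show ?thesis
    by (simp add: deg_less_eq_span dim_eq_card_independent independent_monomials card_image inj_on_subset[OF _ subset_UNIV])
qed

section \<open>The grading and explicit form of ideals\<close>

definition homogeneous :: "nat \<Rightarrow> 'n::finite rpoly \<Rightarrow> bool" where
  "homogeneous k p \<longleftrightarrow> (\<forall>m\<in>Poly_Mapping.keys p. mon_degree m = k)"

text \<open>The degree is a fixed parameter here, which makes the map linear;
  \<open>hom_part\<close> is not, since its degree depends on the polynomial.\<close>

definition hom_comp :: "nat \<Rightarrow> 'n::finite rpoly \<Rightarrow> 'n rpoly" where
  "hom_comp n p = Abs_poly_mapping (\<lambda>m. Poly_Mapping.lookup p m when mon_degree m = n)"

lemma lookup_hom_comp: "Poly_Mapping.lookup (hom_comp n p) m = (Poly_Mapping.lookup p m when mon_degree m = n)"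
proof -
  have "finite {m. (Poly_Mapping.lookup p m when mon_degree m = n) \<noteq> 0}"
    by (rule finite_subset[OF _ finite_lookup[of p]]) auto
  then show ?thesis by (simp add: hom_comp_def)
qed

lemma linear_hom_comp: "linear (hom_comp n)"
  by (intro linearI poly_mapping_eqI) (simp_all add: lookup_hom_comp lookup_add when_add_distrib when_def)

lemmas hom_comp_add = linear_add[OF linear_hom_comp]
lemmas hom_comp_sum = linear_sum[OF linear_hom_comp]

lemma hom_comp_single: "hom_comp n (Poly_Mapping.single m c) = (if mon_degree m = n then Poly_Mapping.single m c else 0)"
  by (rule poly_mapping_eqI) (auto simp: lookup_hom_comp lookup_single when_def)

lemma hom_comp_mult_homogeneous:
  assumes "homogeneous k q"
  shows "hom_comp n (p * q) = (if k \<le> n then hom_comp (n - k) p * q else 0)"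
proof -
  have "hom_comp n ((\<Sum>i\<in>A. Poly_Mapping.single i (f i)) * (\<Sum>j\<in>B. Poly_Mapping.single j (g j)))
      = (if k \<le> n then hom_comp (n - k) (\<Sum>i\<in>A. Poly_Mapping.single i (f i)) * (\<Sum>j\<in>B. Poly_Mapping.single j (g j)) else 0)"
    if "\<And>j. j \<in> B \<Longrightarrow> mon_degree j = k" for A B :: "('a \<Rightarrow>\<^sub>0 nat) set" and f g :: "('a \<Rightarrow>\<^sub>0 nat) \<Rightarrow> real"
    using that
    by (auto simp: hom_comp_sum sum_product mult_single hom_comp_single mon_degree_add intro!: sum.cong sum.neutral)
  from this[of "Poly_Mapping.keys q" "Poly_Mapping.lookup p" "Poly_Mapping.keys p" "Poly_Mapping.lookup q"] assms
  show ?thesis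
    using rpoly_as_sum[of p] rpoly_as_sum[of q] by (simp add: homogeneous_def)
qed

lemma hom_comp_deg_less: "p \<in> deg_less n \<Longrightarrow> hom_comp n p = 0"
  by (rule poly_mapping_eqI) (simp add: lookup_hom_comp deg_less_lookup when_def)

lemma diff_hom_comp_deg_less: "p \<in> deg_less (Suc n) \<Longrightarrow> p - hom_comp n p \<in> deg_less n"
  by (auto simp: lookup_hom_comp deg_less_lookup lookup_minus when_def)

lemma hom_comp_in_deg_less: "hom_comp n p \<in> deg_less (Suc n)"
  by (auto simp: lookup_hom_comp deg_less_lookup when_def)

lemma hom_comp_idem [simp]: "hom_comp n (hom_comp n p) = hom_comp n p"
  by (rule poly_mapping_eqI) (simp add: lookup_hom_comp when_def)

text \<open>Cofactors are attached to indices rather than to generators, so \<open>f\<close> may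
  repeat values and later arguments can manipulate families of cofactors.\<close>

lemma ideal_gen_image:
  assumes "finite T"
  shows "ideal_gen (f ` T) = {\<Sum>i\<in>T. h i * f i |h. True}"
proof -
  interpret Modules.module "(*) :: 'n rpoly \<Rightarrow> 'n rpoly \<Rightarrow> 'n rpoly" by (rule module_rpoly)
  show ?thesis unfolding ideal_gen_def
  proof (intro antisym span_minimal)
    show "f ` T \<subseteq> {\<Sum>i\<in>T. h i * f i |h. True}"
    proof clarsimp
      fix i assume "i \<in> T"
      then have "f i = (\<Sum>j\<in>T. (if j = i then 1 else 0) * f j)"
        using assms by (simp add: if_distrib[of "\<lambda>x. x * _"] cong: if_cong)
      then show "\<exists>h. f i = (\<Sum>j\<in>T. h j * f j)" by (rule exI[of _ "\<lambda>j. if j = i then 1 else 0"])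
    qed
    show "subspace {\<Sum>i\<in>T. h i * f i |h. True}"
    proof (rule subspaceI)
      show "0 \<in> {\<Sum>i\<in>T. h i * f i |h. True}" by (auto intro!: exI[of _ "\<lambda>_. 0"])
    next
      fix x y assume "x \<in> {\<Sum>i\<in>T. h i * f i |h. True}" "y \<in> {\<Sum>i\<in>T. h i * f i |h. True}"
      then obtain h h' where "x = (\<Sum>i\<in>T. h i * f i)" "y = (\<Sum>i\<in>T. h' i * f i)" by auto
      then have "x + y = (\<Sum>i\<in>T. (h i + h' i) * f i)" by (simp add: sum.distrib distrib_right)
      then show "x + y \<in> {\<Sum>i\<in>T. h i * f i |h. True}" by (auto intro!: exI[of _ "\<lambda>i. h i + h' i"])
    next
      fix c x assume "x \<in> {\<Sum>i\<in>T. h i * f i |h. True}"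
      then obtain h where "x = (\<Sum>i\<in>T. h i * f i)" by auto
      then have "c * x = (\<Sum>i\<in>T. (c * h i) * f i)" by (simp only: sum_distrib_left mult.assoc)
      then show "c * x \<in> {\<Sum>i\<in>T. h i * f i |h. True}" by (auto intro!: exI[of _ "\<lambda>i. c * h i"])
    qed
    show "{\<Sum>i\<in>T. h i * f i |h. True} \<subseteq> span (f ` T)"
    proof clarify
      fix h
      show "(\<Sum>i\<in>T. h i * f i) \<in> span (f ` T)"
        by (rule span_sum, rule span_scale, rule span_base, rule imageI)
    qed
  qed
qed

lemma hom_comp_0_1 [simp]: "hom_comp 0 1 = (1 :: 'n::finite rpoly)"
  using hom_comp_single[of 0 "0 :: 'n \<Rightarrow>\<^sub>0 nat" 1] by simp

section \<open>The codimension of an ideal with regular quadratic leading forms\<close>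

text \<open>\<open>q\<close> holds the leading forms and \<open>F\<close> the system with affine
  terms added. \<open>regular\<close> is completeness at infinity in contrapositive form; the order
  of the indices is the order of the regular sequence.\<close>

locale quadratic_regular =
  fixes q F :: "'n::{finite,linorder} \<Rightarrow> 'n rpoly"
  assumes hom: "homogeneous 2 (q i)"
    and regular: "g * q i \<in> ideal_gen (q ` {..<i}) \<Longrightarrow> g \<in> ideal_gen (q ` {..<i})"
    and low: "F i - q i \<in> deg_less 2"
begin

text \<open>For \<open>n < 2\<close> the truncated difference \<open>n - 2 = 0\<close> forces the cofactors to vanish, as it should.\<close>

definition ideal_deg :: "'n set \<Rightarrow> nat \<Rightarrow> 'n rpoly set" where
  "ideal_deg T n = {\<Sum>i\<in>T. g i * F i |g. \<forall>i. g i \<in> deg_less (n - 2)}"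

section \<open>Degree bounds and the filtration of the ideal by the degrees of the cofactors\<close>

lemma q_deg: "q i \<in> deg_less 3"
  using hom[of i] by (auto simp: homogeneous_def deg_less_def)

lemma F_deg: "F i \<in> deg_less 3"
  using subspace_add[OF subspace_deg_less subsetD[OF deg_less_mono low, of 3 i] q_deg[of i]] by simp

lemma mult_F_deg: "g \<in> deg_less a \<Longrightarrow> g * F i \<in> deg_less (a + 2)"
  by (rule deg_less_mult) (use F_deg[of i] in simp_all)

lemma mult_F_deg_pred: "g \<in> deg_less (s - 1) \<Longrightarrow> g * F i \<in> deg_less (Suc s)"
  using deg_less_mult_pred[of g s "F i" 1] F_deg[of i] by (simp add: eval_nat_numeral(3) numeral_2_eq_2)

lemma mult_low_deg: "g \<in> deg_less a \<Longrightarrow> g * (F i - q i) \<in> deg_less (Suc a)"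
  using deg_less_mult[of g a "F i - q i" 1] low[of i] by (simp add: numeral_2_eq_2)

lemma mult_low_deg_pred: "g \<in> deg_less (s - 1) \<Longrightarrow> g * (F i - q i) \<in> deg_less s"
  using deg_less_mult_pred[of g s "F i - q i" 0] low[of i] by (simp add: numeral_2_eq_2)

lemma subspace_ideal_deg: "subspace (ideal_deg T n)"
proof (rule subspaceI)
  show "0 \<in> ideal_deg T n"
    unfolding ideal_deg_def by (auto intro!: exI[of _ "\<lambda>_. 0"] simp: subspace_0[OF subspace_deg_less])
next
  fix x y assume "x \<in> ideal_deg T n" "y \<in> ideal_deg T n"
  then obtain g h where g: "x = (\<Sum>i\<in>T. g i * F i)" "\<And>i. g i \<in> deg_less (n - 2)"
    and h: "y = (\<Sum>i\<in>T. h i * F i)" "\<And>i. h i \<in> deg_less (n - 2)"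
    unfolding ideal_deg_def by blast
  have "x + y = (\<Sum>i\<in>T. (g i + h i) * F i)" by (simp add: g h sum.distrib distrib_right)
  then show "x + y \<in> ideal_deg T n"
    unfolding ideal_deg_def using subspace_add[OF subspace_deg_less g(2) h(2)]
    by (intro CollectI exI[of _ "\<lambda>i. g i + h i"]) simp
next
  fix c x assume "x \<in> ideal_deg T n"
  then obtain g where g: "x = (\<Sum>i\<in>T. g i * F i)" "\<And>i. g i \<in> deg_less (n - 2)"
    unfolding ideal_deg_def by blast
  have "c *\<^sub>R x = (\<Sum>i\<in>T. (c *\<^sub>R g i) * F i)" by (simp add: g scaleR_sum_right)
  then show "c *\<^sub>R x \<in> ideal_deg T n"
    unfolding ideal_deg_def using subspace_scale[OF subspace_deg_less g(2)]
    by (intro CollectI exI[of _ "\<lambda>i. c *\<^sub>R g i"]) simp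
qed

text \<open>\<open>ideal_deg\<close> bounds the cofactors at all indices; those outside
  \<open>T\<close> can be reset to zero.\<close>

lemma ideal_degI: "(\<And>i. i \<in> T \<Longrightarrow> g i \<in> deg_less (n - 2)) \<Longrightarrow> (\<Sum>i\<in>T. g i * F i) \<in> ideal_deg T n"
  unfolding ideal_deg_def
  by (intro CollectI exI[of _ "\<lambda>i. if i \<in> T then g i else 0"])
    (auto intro: sum.cong simp: subspace_0[OF subspace_deg_less])

lemma ideal_deg_mono: "m \<le> n \<Longrightarrow> ideal_deg T m \<subseteq> ideal_deg T n"
  unfolding ideal_deg_def using subsetD[OF deg_less_mono[of "m - 2" "n - 2"]] by fastforce

lemma ideal_deg_subset_deg_less: "ideal_deg T n \<subseteq> deg_less n"
proof
  fix f assume "f \<in> ideal_deg T n"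
  then obtain g where g: "f = (\<Sum>i\<in>T. g i * F i)" "\<And>i. g i \<in> deg_less (n - 2)"
    unfolding ideal_deg_def by blast
  have "g i * F i \<in> deg_less n" for i
  proof (cases "n \<ge> 2")
    case True
    then show ?thesis using mult_F_deg[OF g(2), of i i] by (metis le_add_diff_inverse2)
  next
    case False
    then show ?thesis using g(2)[of i] by (simp add: subspace_0[OF subspace_deg_less])
  qed
  then show "f \<in> deg_less n"
    unfolding g(1) by (intro subspace_sum[OF subspace_deg_less])
qed

text \<open>Only one degree of an ideal membership matters for a form: each cofactor may be replaced
  by its component of degree \<open>s - 2\<close>, and by zero if \<open>s < 2\<close>.\<close>

lemma homogeneous_cofactors:
  assumes t: "hom_comp s t = t" and "t * q k \<in> ideal_gen (q ` {..<k})"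
  obtains h where "t = (\<Sum>i<k. h i * q i)" "\<And>i. h i \<in> deg_less (s - 1)"
proof -
  have "t \<in> ideal_gen (q ` {..<k})" using assms regular by blast
  then obtain h' where h': "t = (\<Sum>i<k. h' i * q i)" by (auto simp: ideal_gen_image)
  define h where "h i = (if 2 \<le> s then hom_comp (s - 2) (h' i) else 0)" for i
  have "t = (\<Sum>i<k. hom_comp s (h' i * q i))"
    using t by (subst t[symmetric]) (simp add: h' hom_comp_sum)
  also have "\<dots> = (\<Sum>i<k. h i * q i)"
    by (intro sum.cong refl) (simp add: h_def hom_comp_mult_homogeneous[OF hom])
  finally have "t = (\<Sum>i<k. h i * q i)" .
  moreover have "h i \<in> deg_less (s - 1)" for i
    using hom_comp_in_deg_less[of "s - 2" "h' i"]
    by (auto simp: h_def subspace_0[OF subspace_deg_less] Suc_diff_Suc numeral_2_eq_2)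
  ultimately show ?thesis by (rule that)
qed

text \<open>The division step. Regularity writes the leading part of \<open>g\<close> through the
  earlier forms; subtracting the same combination of the \<open>F i\<close> cancels it, at the price
  of terms with \<open>F i - q i\<close>, which have lower degree.\<close>

lemma reduce_leading:
  assumes g: "g \<in> deg_less (Suc s)" and t: "hom_comp s g * q k \<in> ideal_gen (q ` {..<k})"
  obtains h where "g - (\<Sum>i<k. h i * F i) \<in> deg_less s" "\<And>i. h i \<in> deg_less (s - 1)"
proof -
  obtain h where h: "hom_comp s g = (\<Sum>i<k. h i * q i)" "\<And>i. h i \<in> deg_less (s - 1)"
    using homogeneous_cofactors[OF hom_comp_idem t] by blast
  have "g - (\<Sum>i<k. h i * F i) = (g - hom_comp s g) - (\<Sum>i<k. h i * (F i - q i))"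
    by (simp add: h(1) right_diff_distrib sum_subtractf)
  also have "\<dots> \<in> deg_less s"
    by (rule subspace_diff[OF subspace_deg_less diff_hom_comp_deg_less[OF g] subspace_sum[OF subspace_deg_less mult_low_deg_pred[OF h(2)]]])
  finally show ?thesis using h(2) by (rule that)
qed

lemma hom_comp_mult_F:
  assumes "g \<in> deg_less (Suc s)"
  shows "hom_comp (Suc (Suc s)) (g * F i) = hom_comp s g * q i"
proof -
  have "hom_comp (Suc (Suc s)) (g * (F i - q i)) = 0"
    by (rule hom_comp_deg_less[OF mult_low_deg[OF assms]])
  moreover have "g * F i = g * q i + g * (F i - q i)" by (simp add: right_diff_distrib)
  ultimately show ?thesis
    using hom_comp_mult_homogeneous[OF hom, of "Suc (Suc s)" g i] by (simp add: hom_comp_add)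
qed

text \<open>Initial segments are kept as down-closed sets to cover both \<open>{..<k}\<close> and
  \<open>UNIV\<close>; inductions on their size split off the largest index.\<close>

lemma down_closed_Max:
  fixes T :: "'n set"
  assumes down: "\<And>i j. i \<in> T \<Longrightarrow> j < i \<Longrightarrow> j \<in> T" and "T \<noteq> {}"
  shows "T = insert (Max T) {..<Max T}"
proof (intro antisym subsetI)
  fix i assume "i \<in> T"
  then show "i \<in> insert (Max T) {..<Max T}" using Max_ge[of T i] by (auto simp: less_le)
next
  fix i assume "i \<in> insert (Max T) {..<Max T}"
  then show "i \<in> T" using down[of "Max T" i] Max_in[OF finite[of T] assms(2)] by auto
qed

text \<open>A syzygy of the leading forms lowers the degree of the top cofactor, by regularity.\<close>

lemma ideal_deg_Suc_Int_deg_less: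
  assumes "\<And>i j. i \<in> T \<Longrightarrow> j < i \<Longrightarrow> j \<in> T"
    and "f \<in> ideal_deg T (Suc n)" "f \<in> deg_less n"
  shows "f \<in> ideal_deg T n"
  using assms
proof (induction "card T" arbitrary: T f rule: less_induct)
  case less
  show ?case
  proof (cases "n < 2 \<or> T = {}")
    case True
    \<comment> \<open>For \<open>n < 2\<close> both truncated differences are 0, so the two levels
      of the filtration coincide.\<close>
    then consider "n - 2 = Suc n - 2" | "T = {}" by linarith
    then show ?thesis
    proof cases
      case 1
      then show ?thesis using less.prems(2) by (simp add: ideal_deg_def)
    next
      case 2
      then have "f = 0" using less.prems(2) by (auto simp: ideal_deg_def)
      then show ?thesis by (simp add: subspace_0[OF subspace_ideal_deg])
    qed
  next
    case False
    then obtain s where n: "n = Suc (Suc s)" by (metis Suc_diff_le diff_Suc_Suc diff_diff_left le_add_diff_inverse less_2_cases_iff not0_implies_Suc One_nat_def)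
    define k where "k = Max T"
    define T' where "T' = {..<k}"
    have T: "T = insert k T'" "k \<notin> T'" "finite T'"
      using down_closed_Max[OF less.prems(1)] False by (auto simp: k_def T'_def)
    obtain g where g: "f = (\<Sum>i\<in>T. g i * F i)" "\<And>i. g i \<in> deg_less (Suc s)"
      using less.prems(2) unfolding ideal_deg_def n by auto
    have "0 = hom_comp n f" using hom_comp_deg_less less.prems(3) by simp
    also have "\<dots> = (\<Sum>i\<in>T. hom_comp s (g i) * q i)"
      unfolding g(1) n by (simp only: hom_comp_sum hom_comp_mult_F[OF g(2)])
    finally have "hom_comp s (g k) * q k = (\<Sum>i\<in>T'. (- hom_comp s (g i)) * q i)"
      using T by (simp add: sum_negf eq_neg_iff_add_eq_0)
    then have "hom_comp s (g k) * q k \<in> ideal_gen (q ` {..<k})"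
      by (subst ideal_gen_image) (auto simp: T'_def simp del: mult_minus_left)
    then obtain h where h: "g k - (\<Sum>i<k. h i * F i) \<in> deg_less s" "\<And>i. h i \<in> deg_less (s - 1)"
      using reduce_leading[OF g(2)] by blast
    \<comment> \<open>The correction is moved from the cofactor of \<open>F k\<close> to the others:
      \<open>h i * F i * F k\<close> is absorbed in the cofactor of \<open>F i\<close>, and the new
      cofactor of \<open>F k\<close> has lost one degree.\<close>
    define g' where "g' = g k - (\<Sum>i\<in>T'. h i * F i)"
    define f' where "f' = (\<Sum>i\<in>T'. (g i + h i * F k) * F i)"
    have g': "g' \<in> deg_less s" using h by (simp add: g'_def T'_def)
    have f: "f = g' * F k + f'"
      by (simp add: g(1) T g'_def f'_def algebra_simps sum.distrib sum_distrib_left)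
    have hF: "g i + h i * F k \<in> deg_less (Suc s)" for i
      by (rule subspace_add[OF subspace_deg_less g(2) mult_F_deg_pred[OF h(2)]])
    have g'F: "g' * F k \<in> deg_less n"
      using mult_F_deg[OF g', of k] by (simp add: n)
    have "f' = f - g' * F k" using f by simp
    then have "f' \<in> deg_less n"
      using subspace_diff[OF subspace_deg_less less.prems(3) g'F] by simp
    moreover have "f' \<in> ideal_deg T' (Suc n)"
      unfolding f'_def by (rule ideal_degI) (use hF n in simp)
    ultimately have "f' \<in> ideal_deg T' n"
      using less.hyps[of T' f'] T by (auto simp: T'_def)
    then obtain u where u: "f' = (\<Sum>i\<in>T'. u i * F i)" "\<And>i. u i \<in> deg_less s"
      unfolding ideal_deg_def n by auto
    have "f = (\<Sum>i\<in>T. (if i = k then g' else u i) * F i)"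
      using T by (simp add: f u(1)) (intro sum.cong refl, auto)
    also have "\<dots> \<in> ideal_deg T n"
      by (rule ideal_degI) (use g' u n in auto)
    finally show ?thesis .
  qed
qed

text \<open>Descent by single degrees from \<open>m\<close> to \<open>n\<close>. The result is that
  cofactors never need higher degree than the element itself suggests, so the filtration by
  cofactors is the degree filtration of the ideal.\<close>

lemma ideal_deg_Int_deg_less:
  assumes down: "\<And>i j. i \<in> T \<Longrightarrow> j < i \<Longrightarrow> j \<in> T"
    and f: "f \<in> ideal_deg T m" "f \<in> deg_less n"
  shows "f \<in> ideal_deg T n"
proof (cases "m \<le> n")
  case True
  then show ?thesis using f ideal_deg_mono by blast
next
  case False
  then have "n \<le> m" by simp
  then show ?thesis
    using f(1)
  proof (induction m rule: dec_induct)
    case (step m)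
    then have "f \<in> deg_less m" using f(2) deg_less_mono by blast
    then show ?case using ideal_deg_Suc_Int_deg_less[of T f m] down step.prems step.IH by blast
  qed
qed

text \<open>Regularity passes from the leading forms to the \<open>F i\<close>, with degree control.
  The element \<open>e\<close> of the smaller ideal carries the leading part of \<open>g\<close>,
  and the induction hypothesis treats \<open>g - e\<close>.\<close>

lemma regular_ideal_deg:
  assumes "g \<in> deg_less n" "g * F k \<in> ideal_deg {..<k} (n + 2)"
  shows "g \<in> ideal_deg {..<k} n"
  using assms
proof (induction n arbitrary: g)
  case 0
  then show ?case by (simp add: subspace_0[OF subspace_ideal_deg])
next
  case (Suc n)
  obtain u where u: "g * F k = (\<Sum>i<k. u i * F i)" "\<And>i. u i \<in> deg_less (Suc n)"
    using Suc.prems(2) unfolding ideal_deg_def by auto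
  have "hom_comp n g * q k = hom_comp (Suc (Suc n)) (g * F k)"
    using hom_comp_mult_F[OF Suc.prems(1)] by simp
  also have "\<dots> = (\<Sum>i<k. hom_comp n (u i) * q i)"
    unfolding u(1) by (simp only: hom_comp_sum hom_comp_mult_F[OF u(2)])
  finally have "hom_comp n g * q k \<in> ideal_gen (q ` {..<k})"
    by (subst ideal_gen_image) auto
  then obtain h where h: "g - (\<Sum>i<k. h i * F i) \<in> deg_less n" "\<And>i. h i \<in> deg_less (n - 1)"
    using reduce_leading[OF Suc.prems(1)] by blast
  define e where "e = (\<Sum>i<k. h i * F i)"
  have e: "e \<in> ideal_deg {..<k} (Suc n)"
    unfolding e_def by (rule ideal_degI) (use h in simp)
  have "e * F k = (\<Sum>i<k. (h i * F k) * F i)"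
    unfolding e_def sum_distrib_right by (intro sum.cong refl) (simp add: mult_ac)
  also have "\<dots> \<in> ideal_deg {..<k} (Suc n + 2)"
    by (rule ideal_degI) (use mult_F_deg_pred[OF h(2)] in simp)
  finally have *: "(g - e) * F k \<in> ideal_deg {..<k} (Suc n + 2)"
    using subspace_diff[OF subspace_ideal_deg Suc.prems(2)] by (simp add: left_diff_distrib)
  \<comment> \<open>Membership is known only at level \<open>n + 3\<close>, but the degree is below
    \<open>n + 2\<close>; the descent lemma supplies the level that the induction hypothesis
    demands.\<close>
  have "(g - e) * F k \<in> deg_less (n + 2)"
    by (rule mult_F_deg) (use h in \<open>simp add: e_def\<close>)
  from ideal_deg_Int_deg_less[OF _ * this] have "(g - e) * F k \<in> ideal_deg {..<k} (n + 2)"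
    by (meson lessThan_iff less_trans)
  then have "g - e \<in> ideal_deg {..<k} n"
    using Suc.IH h by (simp add: e_def)
  then have "g - e \<in> ideal_deg {..<k} (Suc n)"
    using ideal_deg_mono[of n "Suc n"] by auto
  from subspace_add[OF subspace_ideal_deg this e] show ?case by simp
qed

text \<open>Otherwise \<open>q k = 0\<close>, which lies in every ideal, and regularity would put 1
  into an ideal generated by forms of degree 2, where no constant terms occur.\<close>

lemma F_nonzero: "F k \<noteq> 0"
proof
  assume "F k = 0"
  then have "hom_comp 2 (q k) = 0" using hom_comp_deg_less[OF low[of k]]
    by (simp add: linear_neg[OF linear_hom_comp])
  moreover have "hom_comp 2 (q k) = q k"
    using hom_comp_mult_homogeneous[OF hom, of 2 1 k] by simp
  ultimately have "1 * q k = (\<Sum>i<k. 0 * q i)" by simp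
  then have "1 * q k \<in> ideal_gen (q ` {..<k})"
    unfolding ideal_gen_image[OF finite] by (intro CollectI exI[of _ "\<lambda>_. 0"] conjI TrueI)
  then have "1 \<in> ideal_gen (q ` {..<k})" by (rule regular)
  then obtain h where h: "1 = (\<Sum>i<k. h i * q i)" by (auto simp: ideal_gen_image)
  have "hom_comp 0 (1::'n rpoly) = (\<Sum>i<k. hom_comp 0 (h i * q i))"
    by (simp only: h hom_comp_sum)
  also have "\<dots> = 0" by (simp add: hom_comp_mult_homogeneous[OF hom])
  finally show False by simp
qed

text \<open>The larger ideal is the sum of the smaller one and the multiples of \<open>F k\<close>,
  and multiplication by \<open>F k\<close> is injective. The formula for the dimension of a sum then
  gives the recursion, once the intersection is known.\<close>

lemma dim_ideal_deg_insert:
  "dim (ideal_deg (insert k {..<k}) n) + dim (ideal_deg {..<k} (n - 2))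
     = dim (ideal_deg {..<k} n) + dim (deg_less (n - 2) :: 'n rpoly set)"
proof -
  have finj: "inj ((*) (F k))"
    by (rule injI) (use F_nonzero in simp)
  note dimF = dim_image_inj_finite[OF linear_mult_rpoly finj]
  have sums: "ideal_deg (insert k {..<k}) n
      = {x + y |x y. x \<in> ideal_deg {..<k} n \<and> y \<in> (*) (F k) ` deg_less (n - 2)}" (is "?L = ?R")
  proof (intro antisym subsetI)
    fix f assume "f \<in> ?L"
    then obtain g where g: "f = (\<Sum>i\<in>insert k {..<k}. g i * F i)" "\<And>i. g i \<in> deg_less (n - 2)"
      unfolding ideal_deg_def by blast
    have "f = (\<Sum>i<k. g i * F i) + F k * g k" by (simp add: g(1) mult.commute)
    moreover have "(\<Sum>i<k. g i * F i) \<in> ideal_deg {..<k} n" by (rule ideal_degI) (rule g(2))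
    ultimately show "f \<in> ?R" using g(2)[of k] by blast
  next
    fix f assume "f \<in> ?R"
    then obtain x u where f: "f = x + F k * u" "x \<in> ideal_deg {..<k} n" "u \<in> deg_less (n - 2)" by blast
    then obtain g where g: "x = (\<Sum>i<k. g i * F i)" "\<And>i. g i \<in> deg_less (n - 2)"
      unfolding ideal_deg_def by blast
    have "f = (\<Sum>i\<in>insert k {..<k}. (if i = k then u else g i) * F i)"
      by (simp add: f(1) g(1) mult.commute) (intro sum.cong refl, auto)
    also have "\<dots> \<in> ?L" by (rule ideal_degI) (use f g in auto)
    finally show "f \<in> ?L" .
  qed
  \<comment> \<open>This is where regularity enters: a multiple of \<open>F k\<close> lies in the
    smaller ideal only if its cofactor does.\<close>
  have Int: "ideal_deg {..<k} n \<inter> (*) (F k) ` deg_less (n - 2) = (*) (F k) ` ideal_deg {..<k} (n - 2)" (is "?L = ?R")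
  proof (cases "n \<ge> 2")
    case True
    show ?thesis
    proof (intro antisym subsetI)
      fix f assume "f \<in> ?L"
      then obtain u where "f = F k * u" "u \<in> deg_less (n - 2)" "f \<in> ideal_deg {..<k} n" by blast
      then show "f \<in> ?R"
        using regular_ideal_deg[of u "n - 2" k] True by (auto simp: mult.commute[of u] simp del: add_2_eq_Suc')
    next
      fix f assume "f \<in> ?R"
      then obtain u where u: "f = F k * u" "u \<in> ideal_deg {..<k} (n - 2)" by blast
      then obtain g where g: "u = (\<Sum>i<k. g i * F i)" "\<And>i. g i \<in> deg_less (n - 2 - 2)"
        unfolding ideal_deg_def by blast
      have "f = (\<Sum>i<k. (g i * F k) * F i)" by (simp add: u g(1) sum_distrib_left mult_ac)
      also have "\<dots> \<in> ideal_deg {..<k} n"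
      proof (rule ideal_degI)
        show "g i * F k \<in> deg_less (n - 2)" for i
        \<comment> \<open>For \<open>n < 4\<close> the doubly truncated bound is 0, so
          \<open>g i\<close> vanishes.\<close>
        proof (cases "n \<ge> 4")
          case True
          then have "n - 2 = n - 2 - 2 + 2" by simp
          then show ?thesis
            using mult_F_deg[OF g(2), of i k] by simp
        next
          case False
          then show ?thesis using g(2)[of i] by (simp add: subspace_0[OF subspace_deg_less])
        qed
      qed
      finally have "f \<in> ideal_deg {..<k} n" .
      then show "f \<in> ?L" using u ideal_deg_subset_deg_less by blast
    qed
  next
    case False
    then show ?thesis
      using subspace_0[OF subspace_ideal_deg] ideal_deg_subset_deg_less[of "{..<k}" 0] by (auto simp: image_iff)
  qed
  have "(*) (F k) ` deg_less (n - 2) \<subseteq> ideal_deg (insert k {..<k}) n"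
  proof (rule image_subsetI)
    fix u :: "'n rpoly" assume "u \<in> deg_less (n - 2)"
    moreover have "F k * u = 0 + F k * u" by simp
    ultimately show "F k * u \<in> ideal_deg (insert k {..<k}) n"
      unfolding sums using subspace_0[OF subspace_ideal_deg] by blast
  qed
  then have sub: "(*) (F k) ` deg_less (n - 2) \<subseteq> deg_less n"
    using ideal_deg_subset_deg_less by (rule order_trans)
  have "dim {x + y |x y. x \<in> ideal_deg {..<k} n \<and> y \<in> (*) (F k) ` deg_less (n - 2)}
      + dim (ideal_deg {..<k} n \<inter> (*) (F k) ` deg_less (n - 2))
      = dim (ideal_deg {..<k} n) + dim ((*) (F k) ` deg_less (n - 2))"
  proof (rule dim_sum_Int_finite[OF subspace_ideal_deg])
    show "subspace ((*) (F k) ` deg_less (n - 2))"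
      by (rule linear_subspace_image[OF linear_mult_rpoly subspace_deg_less])
    show "finite ((\<lambda>m. Poly_Mapping.single m (1::real)) ` {m :: 'n \<Rightarrow>\<^sub>0 nat. mon_degree m < n})"
      by (simp add: finite_mon_degree_less)
  qed (use sub ideal_deg_subset_deg_less[of "{..<k}" n] in \<open>simp_all add: deg_less_eq_span[of n]\<close>)
  then show ?thesis
    unfolding sums Int dimF .
qed

text \<open>The monomials divisible by no Y_i^2 with i in \<open>T\<close>, a basis modulo the ideal
  of these squares. That ideal itself is never formed; only cardinalities are compared.\<close>

definition standard_monomials :: "'n set \<Rightarrow> nat \<Rightarrow> ('n \<Rightarrow>\<^sub>0 nat) set" where
  "standard_monomials T n = {m. mon_degree m < n \<and> (\<forall>i\<in>T. Poly_Mapping.lookup m i \<le> 1)}"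

lemma finite_standard_monomials: "finite (standard_monomials T n)"
  by (rule finite_subset[OF _ finite_mon_degree_less[of n]]) (auto simp: standard_monomials_def)

text \<open>Multiplication by Y_k^2 maps the monomials of degree below \<open>n - 2\<close> onto
  those lost by passing to \<open>insert k T\<close>. This is the recursion of
  \<open>dim_ideal_deg_insert\<close>, read for codimensions.\<close>

lemma card_standard_monomials_insert:
  assumes "k \<notin> T"
  shows "card (standard_monomials T n) = card (standard_monomials (insert k T) n) + card (standard_monomials T (n - 2))"
proof -
  define sh where "sh = (\<lambda>m :: 'n \<Rightarrow>\<^sub>0 nat. m + Poly_Mapping.single k 2)"
  have "bij_betw sh (standard_monomials T (n - 2)) (standard_monomials T n - standard_monomials (insert k T) n)"
  proof (rule bij_betwI[where g = "\<lambda>m. m - Poly_Mapping.single k 2"])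
    show "sh \<in> standard_monomials T (n - 2) \<rightarrow> standard_monomials T n - standard_monomials (insert k T) n"
      using assms by (auto simp: sh_def standard_monomials_def mon_degree_add lookup_add lookup_single when_def)
    show "(\<lambda>m. m - Poly_Mapping.single k 2) \<in> standard_monomials T n - standard_monomials (insert k T) n \<rightarrow> standard_monomials T (n - 2)"
    proof
      fix m assume m: "m \<in> standard_monomials T n - standard_monomials (insert k T) n"
      then have k: "Poly_Mapping.lookup m k \<ge> 2" by (auto simp: standard_monomials_def)
      then have "m = (m - Poly_Mapping.single k 2) + Poly_Mapping.single k 2"
        by (auto intro!: poly_mapping_eqI simp: lookup_add lookup_minus lookup_single when_def)
      then have "mon_degree m = mon_degree (m - Poly_Mapping.single k 2) + 2"
        by (metis mon_degree_add mon_degree_single)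
      with m assms show "m - Poly_Mapping.single k 2 \<in> standard_monomials T (n - 2)"
        by (auto simp: standard_monomials_def lookup_minus lookup_single when_def)
    qed
    show "sh m - Poly_Mapping.single k 2 = m" for m by (simp add: sh_def)
    show "sh (m - Poly_Mapping.single k 2) = m" if "m \<in> standard_monomials T n - standard_monomials (insert k T) n" for m
      using that by (auto intro!: poly_mapping_eqI simp: sh_def standard_monomials_def lookup_add lookup_minus lookup_single when_def)
  qed
  then have "card (standard_monomials T (n - 2)) = card (standard_monomials T n - standard_monomials (insert k T) n)"
    by (rule bij_betw_same_card)
  moreover have "standard_monomials (insert k T) n \<subseteq> standard_monomials T n"
    by (auto simp: standard_monomials_def)
  ultimately show ?thesis
    by (simp add: card_Diff_subset finite_standard_monomials card_mono)
qed

lemma dim_deg_less_eq: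
  assumes "\<And>i j. i \<in> T \<Longrightarrow> j < i \<Longrightarrow> j \<in> T"
  shows "dim (deg_less n :: 'n rpoly set) = dim (ideal_deg T n) + card (standard_monomials T n)"
  using assms
proof (induction "card T" arbitrary: T n rule: less_induct)
  case less
  show ?case
  proof (cases "T = {}")
    case True
    then have "ideal_deg T n \<subseteq> {0}" by (auto simp: ideal_deg_def)
    then have "dim (ideal_deg T n) = 0" using dim_le_card[of "ideal_deg T n" "{}"] by simp
    then show ?thesis using True by (simp add: standard_monomials_def dim_deg_less)
  next
    case False
    define k where "k = Max T"
    have T: "T = insert k {..<k}"
      using down_closed_Max[OF less.prems False] by (simp add: k_def)
    have IH: "dim (deg_less n :: 'n rpoly set) = dim (ideal_deg {..<k} n) + card (standard_monomials {..<k} n)" for n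
    proof (rule less.hyps)
      show "card {..<k} < card T" by (subst T) simp
    qed auto
    have "card (standard_monomials {..<k} n) = card (standard_monomials T n) + card (standard_monomials {..<k} (n - 2))"
      by (subst T, rule card_standard_monomials_insert) simp
    with IH[of n] IH[of "n - 2"] dim_ideal_deg_insert[of k n] show ?thesis
      unfolding T[symmetric] by linarith
  qed
qed

text \<open>Squarefree monomials correspond to sets of variables; their degree is at most d, so the
  bound \<open>n\<close> excludes none of them.\<close>

lemma card_standard_monomials_UNIV:
  assumes "CARD('n) < n"
  shows "card (standard_monomials UNIV n) = 2 ^ CARD('n)"
proof -
  have *: "mon_degree m \<le> CARD('n)" if "\<And>i. Poly_Mapping.lookup m i \<le> 1" for m :: "'n \<Rightarrow>\<^sub>0 nat"
    using sum_mono[of UNIV "Poly_Mapping.lookup m" "\<lambda>_. 1"] that by (simp add: mon_degree_def)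
  have lk: "Poly_Mapping.lookup (Abs_poly_mapping (\<lambda>i. if i \<in> S then 1 else 0 :: nat)) = (\<lambda>i. if i \<in> S then 1 else 0)" for S :: "'n set"
    by simp
  have "bij_betw (\<lambda>m. Poly_Mapping.keys m) (standard_monomials UNIV n) (UNIV :: 'n set set)"
  proof (rule bij_betwI[where g = "\<lambda>S. Abs_poly_mapping (\<lambda>i. if i \<in> S then 1 else 0)"])
    show "(\<lambda>S. Abs_poly_mapping (\<lambda>i. if i \<in> S then 1 else 0)) \<in> UNIV \<rightarrow> standard_monomials UNIV n"
      by (auto simp: standard_monomials_def intro!: le_less_trans[OF * assms])
    show "Poly_Mapping.keys (Abs_poly_mapping (\<lambda>i. if i \<in> S then 1 else 0 :: nat)) = S" for S :: "'n set"
      by (auto simp: in_keys_iff split: if_splits)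
    show "Abs_poly_mapping (\<lambda>i. if i \<in> Poly_Mapping.keys m then 1 else 0) = m" if "m \<in> standard_monomials UNIV n" for m
    proof (rule poly_mapping_eqI)
      fix i
      have "Poly_Mapping.lookup m i \<le> 1" using that by (simp add: standard_monomials_def)
      then show "Poly_Mapping.lookup (Abs_poly_mapping (\<lambda>i. if i \<in> Poly_Mapping.keys m then 1 else 0)) i = Poly_Mapping.lookup m i"
        by (auto simp: in_keys_iff)
    qed
  qed auto
  then show ?thesis
    using bij_betw_same_card card_UNIV_set by (metis (no_types) Pow_UNIV card_Pow finite)
qed

section \<open>From the filtration to the quotient algebra\<close>

lemma ideal_gen_F_eq: "ideal_gen (range F) = (\<Union>n. ideal_deg UNIV n)"
proof (intro antisym subsetI)
  fix f assume "f \<in> ideal_gen (range F)"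
  then obtain h where h: "f = (\<Sum>i\<in>UNIV. h i * F i)" using ideal_gen_image[of UNIV F] by auto
  define d where "d i = (SOME n. h i \<in> deg_less n)" for i
  have d: "h i \<in> deg_less (d i)" for i
    unfolding d_def by (rule someI_ex[OF in_deg_less])
  have "h i \<in> deg_less (Max (range d) + 2 - 2)" for i
    using subsetD[OF deg_less_mono d, of i "Max (range d)"] by simp
  then have "f \<in> ideal_deg UNIV (Max (range d) + 2)" unfolding h by (intro ideal_degI)
  then show "f \<in> (\<Union>n. ideal_deg UNIV n)" by blast
next
  fix f assume "f \<in> (\<Union>n. ideal_deg UNIV n)"
  then show "f \<in> ideal_gen (range F)"
    by (subst ideal_gen_image) (auto simp: ideal_deg_def)
qed

lemma subspace_ideal_gen_F: "subspace (ideal_gen (range F))"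
proof (rule subspaceI)
  show "0 \<in> ideal_gen (range F)"
    unfolding ideal_gen_F_eq using subspace_0[OF subspace_ideal_deg] by blast
next
  fix x y assume "x \<in> ideal_gen (range F)" "y \<in> ideal_gen (range F)"
  then obtain m n where "x \<in> ideal_deg UNIV m" "y \<in> ideal_deg UNIV n"
    unfolding ideal_gen_F_eq by blast
  then have "x \<in> ideal_deg UNIV (max m n)" "y \<in> ideal_deg UNIV (max m n)"
    using ideal_deg_mono[of m "max m n" UNIV] ideal_deg_mono[of n "max m n" UNIV] by auto
  then show "x + y \<in> ideal_gen (range F)"
    unfolding ideal_gen_F_eq using subspace_add[OF subspace_ideal_deg] by blast
next
  fix c x assume "x \<in> ideal_gen (range F)"
  then show "c *\<^sub>R x \<in> ideal_gen (range F)"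
    unfolding ideal_gen_F_eq using subspace_scale[OF subspace_ideal_deg] by blast
qed

text \<open>From level d + 1 on the codimension is constantly 2^d. A complement found at that level
  therefore serves all higher ones: it meets the ideal trivially because low-degree ideal elements
  descend to level d + 1, and it is large enough by counting dimensions.\<close>

lemma ideal_complement:
  obtains C where "independent C" "finite C" "card C = 2 ^ CARD('n)"
    "span C \<inter> ideal_gen (range F) = {0}"
    "\<And>f. \<exists>w\<in>span C. f - w \<in> ideal_gen (range F)"
proof -
  let ?N = "Suc (CARD('n))"
  have fin: "finite ((\<lambda>m. Poly_Mapping.single m (1::real)) ` {m :: 'n \<Rightarrow>\<^sub>0 nat. mon_degree m < n})" for n
    by (simp add: finite_mon_degree_less)
  have dims: "dim (deg_less n :: 'n rpoly set) = dim (ideal_deg UNIV n) + 2 ^ CARD('n)" if "n \<ge> ?N" for n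
    using dim_deg_less_eq[of UNIV n] card_standard_monomials_UNIV[of n] that by simp
  obtain B where B: "B \<subseteq> ideal_deg UNIV ?N" "independent B" "ideal_deg UNIV ?N \<subseteq> span B"
      "card B = dim (ideal_deg UNIV ?N)"
    by (rule basis_exists)
  have "B \<subseteq> deg_less ?N" using B(1) ideal_deg_subset_deg_less by (rule order_trans)
  then obtain D where D: "B \<subseteq> D" "D \<subseteq> deg_less ?N" "independent D" "deg_less ?N \<subseteq> span D"
    by (rule maximal_independent_subset_extend[OF _ B(2)])
  have spanB: "span B = ideal_deg UNIV ?N"
    by (rule antisym[OF span_minimal[OF B(1) subspace_ideal_deg] B(3)])
  have finD: "finite D"
    using independent_span_bound[OF fin[of ?N] D(3)] D(2) unfolding deg_less_eq_span by blast
  define C where "C = D - B"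
  have indC: "independent C" unfolding C_def using D(3) by (rule independent_mono) simp
  have CN: "span C \<subseteq> deg_less ?N"
    by (rule span_minimal[OF _ subspace_deg_less]) (use D(2) C_def in auto)
  have "card D = dim (deg_less ?N :: 'n rpoly set)" using basis_card_eq_dim[OF D(2,4,3)] .
  moreover have "card C = card D - card B"
    unfolding C_def by (rule card_Diff_subset[OF finite_subset[OF D(1) finD] D(1)])
  ultimately have cardC: "card C = 2 ^ CARD('n)" using dims[of ?N] B(4) by simp
  have disj: "span C \<inter> ideal_deg UNIV n = {0}" for n
  proof -
    have "x = 0" if x: "x \<in> span C" "x \<in> ideal_deg UNIV n" for x
    proof -
      have "x \<in> deg_less ?N" using x(1) CN by blast
      from ideal_deg_Int_deg_less[OF _ x(2) this] have "x \<in> span B" unfolding spanB by simp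
      moreover have "span B \<inter> span C = {0}"
        by (rule span_Int_span_disjoint[OF D(3)]) (use D(1) C_def in auto)
      ultimately show "x = 0" using x(1) by blast
    qed
    then show ?thesis using span_zero subspace_0[OF subspace_ideal_deg] by blast
  qed
  have all: "\<exists>w\<in>span C. f - w \<in> ideal_deg UNIV n" if n: "n \<ge> ?N" and f: "f \<in> deg_less n" for f n
  proof -
    let ?S = "{x + y |x y. x \<in> ideal_deg UNIV n \<and> y \<in> span C}"
    have Cn: "span C \<subseteq> deg_less n" using CN deg_less_mono[OF n] by (rule order_trans)
    have sub: "?S \<subseteq> deg_less n"
      using Cn ideal_deg_subset_deg_less[of UNIV n] subspace_add[OF subspace_deg_less] by blast
    have "dim ?S + dim (ideal_deg UNIV n \<inter> span C) = dim (ideal_deg UNIV n) + dim (span C)"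
      by (rule dim_sum_Int_finite[OF subspace_ideal_deg subspace_span fin[of n]])
        (use Cn ideal_deg_subset_deg_less[of UNIV n] in \<open>simp_all add: deg_less_eq_span[of n]\<close>)
    moreover have "ideal_deg UNIV n \<inter> span C = {0}" using disj[of n] by (simp add: Int_commute)
    moreover have "dim {0 :: 'n rpoly} = 0" using dim_le_card[of "{0 :: 'n rpoly}" "{}"] by simp
    ultimately have "dim ?S = dim (deg_less n :: 'n rpoly set)"
      using dims[OF n] cardC by (simp only: dim_span dim_eq_card_independent[OF indC])
    then have "?S = deg_less n"
      using subspace_dim_equal_finite[OF fin[of n] _ subspace_sums[OF subspace_ideal_deg subspace_span] sub]
      by (simp add: deg_less_eq_span[of n])
    then obtain x y where "f = x + y" "x \<in> ideal_deg UNIV n" "y \<in> span C" using f by blast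
    then show ?thesis by (intro bexI[of _ y]) simp_all
  qed
  show ?thesis
  proof
    show "independent C" "finite C" "card C = 2 ^ CARD('n)" using indC cardC finD C_def by simp_all
    show "span C \<inter> ideal_gen (range F) = {0}"
      unfolding ideal_gen_F_eq using disj by blast
    show "\<exists>w\<in>span C. f - w \<in> ideal_gen (range F)" for f
    proof -
      obtain n where "f \<in> deg_less n" using in_deg_less by blast
      then have "f \<in> deg_less (max ?N n)" using deg_less_mono[of n "max ?N n"] by auto
      then show ?thesis unfolding ideal_gen_F_eq using all[of "max ?N n" f] by auto
    qed
  qed
qed

text \<open>Subsets of the variables index the coordinates just to make the dimension 2^d. The
  Euclidean target supplies adjoints and eigenvectors; its multiplication is transported from the
  polynomials later.\<close>

lemma quotient_map:
  obtains \<pi> :: "'n rpoly \<Rightarrow> real ^ ('n set)" where "linear \<pi>" "surj \<pi>"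
    "\<And>f. \<pi> f = 0 \<longleftrightarrow> f \<in> ideal_gen (range F)"
proof -
  let ?I = "ideal_gen (range F)"
  obtain C where C: "independent C" "finite C" "card C = 2 ^ CARD('n)"
    "span C \<inter> ?I = {0}" and dec: "\<And>f. \<exists>w\<in>span C. f - w \<in> ?I"
    using ideal_complement by blast
  obtain B where B: "B \<subseteq> ?I" "independent B" "?I \<subseteq> span B"
    by (rule maximal_independent_subset)
  have spanB: "span B = ?I"
    by (rule antisym[OF span_minimal[OF B(1) subspace_ideal_gen_F] B(3)])
  have "card C = CARD('n set)" using C(3) card_Pow[OF finite[of "UNIV :: 'n set"]] by (simp only: Pow_UNIV)
  then obtain b where b: "bij_betw b C (UNIV :: 'n set set)"
    using finite_same_card_bij[OF C(2) finite] by blast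
  have ind: "independent (B \<union> C)"
    by (rule independent_UnI[OF B(2) C(1)]) (simp only: spanB C(4) Int_commute[of "ideal_gen _"] order_refl)
  \<comment> \<open>The projection along the ideal: basis vectors of the ideal go to 0, those of the
    complement to distinct unit vectors.\<close>
  define \<phi> where "\<phi> x = (if x \<in> C then axis (b x) 1 else 0 :: real ^ ('n set))" for x
  obtain \<pi> where \<pi>: "linear \<pi>" "\<And>x. x \<in> B \<union> C \<Longrightarrow> \<pi> x = \<phi> x"
    using linear_independent_extend[OF ind, of \<phi>] by blast
  have BC: "x \<notin> C" if "x \<in> B" for x
  proof
    assume "x \<in> C"
    then have "x = 0" using that B(1) C(4) span_base by blast
    then show False using \<open>x \<in> C\<close> C(1) dependent_zero by metis
  qed
  have "\<pi> ` B \<subseteq> {0}" using \<pi>(2) BC by (auto simp: \<phi>_def)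
  then have "span (\<pi> ` B) \<subseteq> {0}" by (metis span_minimal subspace_single_0)
  then have ker: "\<pi> f = 0" if "f \<in> ?I" for f
    using that spanB linear_span_image[OF \<pi>(1), of B] by blast
  have img: "\<pi> ` C = range (\<lambda>s. axis s 1)"
  proof -
    have "\<pi> ` C = (\<lambda>x. axis (b x) 1) ` C" using \<pi>(2) by (auto simp: \<phi>_def)
    also have "\<dots> = (\<lambda>s. axis s 1) ` b ` C" by (simp add: image_image)
    also have "b ` C = UNIV" using b by (rule bij_betw_imp_surj_on)
    finally show ?thesis .
  qed
  have "(Basis :: (real ^ ('n set)) set) = range (\<lambda>s. axis s 1)" by (auto simp: Basis_vec_def)
  then have spanC: "\<pi> ` span C = UNIV"
    using linear_span_image[OF \<pi>(1), of C] img span_Basis by metis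
  have inj: "inj_on \<pi> (span C)"
  proof -
    have "independent (\<pi> ` C)"
      using \<open>Basis = range _\<close> img independent_Basis by metis
    moreover have "inj_on \<pi> C"
    proof (rule inj_onI)
      fix x y assume xy: "x \<in> C" "y \<in> C" "\<pi> x = \<pi> y"
      then have "axis (b x) (1::real) = axis (b y) 1" using \<pi>(2) by (simp add: \<phi>_def)
      then have "b x = b y" by (simp add: axis_eq_axis)
      then show "x = y" using xy b by (meson bij_betw_def inj_onD)
    qed
    ultimately show ?thesis using linear_inj_on_span_iff_independent_image[OF \<pi>(1)] by blast
  qed
  show ?thesis
  proof
    show "linear \<pi>" by fact
    show "surj \<pi>" using spanC by blast
    show "\<pi> f = 0 \<longleftrightarrow> f \<in> ?I" for f
    proof
      assume f: "\<pi> f = 0"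
      obtain w where w: "w \<in> span C" "f - w \<in> ?I" using dec by blast
      have "\<pi> w = 0" using ker[OF w(2)] f linear_diff[OF \<pi>(1), of f w] by simp
      then have "w = 0" using inj_onD[OF inj, of w 0] w(1) span_zero linear_0[OF \<pi>(1)] by metis
      then show "f \<in> ?I" using w by simp
    qed (rule ker)
  qed
qed

end

section \<open>Common eigenvectors in odd dimension\<close>

lemma odd_degree_poly_root:
  fixes p :: "real poly"
  assumes odd: "odd (degree p)" and lc: "lead_coeff p > 0"
  shows "\<exists>x. poly p x = 0"
proof -
  \<comment> \<open>\<open>r\<close> is -p(-x). Since the degree is odd it has the leading
    coefficient of \<open>p\<close>, and its positivity far to the right is negativity of
    \<open>p\<close> far to the left.\<close>
  define r where "r = - pcompose p [:0, -1:]"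
  have "lead_coeff r = lead_coeff p"
    using odd lead_coeff_comp[of "[:0, -1 :: real:]" p] by (simp add: r_def)
  then obtain a b where a: "\<And>x. x \<ge> a \<Longrightarrow> poly p x \<ge> lead_coeff p" and b: "\<And>x. x \<ge> b \<Longrightarrow> poly r x \<ge> lead_coeff p"
    using poly_pinfty_gt_lc[of p] poly_pinfty_gt_lc[of r] lc by auto
  define x where "x = max 1 (max a b)"
  have "a \<le> x" "b \<le> x" by (simp_all add: x_def)
  then have "poly p x > 0" using a[of x] lc by linarith
  moreover have "poly p (- x) < 0"
    using b[OF \<open>b \<le> x\<close>] lc by (simp add: r_def poly_pcompose)
  moreover have "- x < x" by (simp add: x_def)
  ultimately show ?thesis using poly_IVT_pos by blast
qed

text \<open>In a basis of \<open>S\<close> the restriction of \<open>T\<close> becomes a matrix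
  whose characteristic polynomial has odd degree \<open>dim S\<close>, hence a real root.\<close>

lemma odd_dim_eigenvector:
  fixes T :: "'a::euclidean_space \<Rightarrow> 'a"
  assumes T: "linear T" and S: "subspace S" and inv: "T ` S \<subseteq> S" and odd: "odd (dim S)"
  obtains r v where "v \<in> S" "v \<noteq> 0" "T v = r *\<^sub>R v"
proof -
  obtain B where B: "B \<subseteq> S" "independent B" "S \<subseteq> span B" "card B = dim S"
    by (rule basis_exists)
  define n where "n = dim S"
  have finB: "finite B" using B(2) by (rule independent_imp_finite)
  then obtain b where b: "bij_betw b {0..<n} B"
    using ex_bij_betw_nat_finite[OF finB] B(4) n_def by metis
  have injb: "inj_on b {0..<n}" and imgb: "b ` {0..<n} = B" using b by (auto simp: bij_betw_def)
  define a where "a i j = representation B (T (b j)) (b i)" for i j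
  have Tb: "T (b j) = (\<Sum>i<n. a i j *\<^sub>R b i)" if "j < n" for j
  proof -
    have "b j \<in> S" using that imgb B(1) by auto
    then have "T (b j) \<in> span B" using inv B(3) by blast
    from real_vector.sum_representation_eq[OF B(2) this finB subset_refl]
    have "(\<Sum>x\<in>B. representation B (T (b j)) x *\<^sub>R x) = T (b j)" .
    then show ?thesis
      using sum.reindex[OF injb, of "\<lambda>x. representation B (T (b j)) x *\<^sub>R x"]
      by (simp add: a_def lessThan_atLeast0 imgb)
  qed
  define A where "A = Matrix.mat n n (\<lambda>(i, j). a i j)"
  have A: "A \<in> carrier_mat n n" by (simp add: A_def)
  have "\<exists>r. poly (char_poly A) r = 0"
    using degree_monic_char_poly[OF A] odd by (intro odd_degree_poly_root) (simp_all add: n_def)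
  then obtain r where "eigenvalue A r" using eigenvalue_root_char_poly[OF A] by blast
  then obtain v where v: "v \<in> carrier_vec n" "v \<noteq> 0\<^sub>v n" "A *\<^sub>v v = r \<cdot>\<^sub>v v"
    using A by (auto simp: eigenvalue_def eigenvector_def)
  have Av: "(\<Sum>j<n. a i j * vec_index v j) = r * vec_index v i" if "i < n" for i
  proof -
    have "vec_index (A *\<^sub>v v) i = r * vec_index v i" using v that by simp
    then show ?thesis using v(1) that by (simp add: A_def scalar_prod_def lessThan_atLeast0)
  qed
  define w where "w = (\<Sum>j<n. vec_index v j *\<^sub>R b j)"
  show ?thesis
  proof (rule that[of w r])
    show "w \<in> S"
      unfolding w_def using imgb B(1) by (intro subspace_sum[OF S] subspace_scale[OF S]) auto
    show "w \<noteq> 0"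
    proof
      assume "w = 0"
      define u where "u x = vec_index v (the_inv_into {0..<n} b x)" for x
      have "(\<Sum>x\<in>B. u x *\<^sub>R x) = w"
        unfolding imgb[symmetric] sum.reindex[OF injb] w_def u_def
        by (simp add: the_inv_into_f_f[OF injb] lessThan_atLeast0)
      then have "u x = 0" if "x \<in> B" for x
        using \<open>w = 0\<close> independentD[OF B(2) finB subset_refl] that by simp
      then have "vec_index v j = 0" if "j < n" for j
        using that imgb the_inv_into_f_f[OF injb, of j] by (force simp: u_def)
      then show False using v by (auto intro!: eq_vecI)
    qed
    have "T w = (\<Sum>j<n. vec_index v j *\<^sub>R (\<Sum>i<n. a i j *\<^sub>R b i))"
      unfolding w_def by (simp add: linear_sum[OF T] linear_scale[OF T] Tb)
    also have "\<dots> = (\<Sum>j<n. \<Sum>i<n. (a i j * vec_index v j) *\<^sub>R b i)"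
      by (simp add: scaleR_sum_right mult.commute)
    also have "\<dots> = (\<Sum>i<n. (\<Sum>j<n. a i j * vec_index v j) *\<^sub>R b i)"
      by (subst sum.swap) (simp add: scaleR_sum_left)
    also have "\<dots> = r *\<^sub>R w"
      by (simp add: Av w_def scaleR_sum_right)
    finally show "T w = r *\<^sub>R w" .
  qed
qed

lemma dim_image_add_dim_kernel:
  fixes f :: "'a::euclidean_space \<Rightarrow> 'b::euclidean_space"
  assumes f: "linear f" and S: "subspace S"
  shows "dim (f ` S) + dim {x \<in> S. f x = 0} = dim S"
proof -
  define K where "K = {x \<in> S. f x = 0}"
  have K: "subspace K"
    unfolding K_def using subspace_inter[OF S linear_subspace_kernel[OF f]] by (simp add: Int_def)
  obtain B where B: "B \<subseteq> K" "independent B" "K \<subseteq> span B" "card B = dim K"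
    by (rule basis_exists)
  have "B \<subseteq> S" using B(1) by (auto simp: K_def)
  then obtain D where D: "B \<subseteq> D" "D \<subseteq> S" "independent D" "S \<subseteq> span D"
    by (rule maximal_independent_subset_extend[OF _ B(2)])
  have spanB: "span B = K" by (rule antisym[OF span_minimal[OF B(1) K] B(3)])
  have spanD: "span D = S" by (rule antisym[OF span_minimal[OF D(2) S] D(4)])
  have BD: "B \<union> (D - B) = D" using D(1) by blast
  have disj: "span B \<inter> span (D - B) = {0}"
    by (rule span_Int_span_disjoint[OF D(3)]) (use D(1) in auto)
  have DS: "span (D - B) \<subseteq> S" using span_mono[of "D - B" D] spanD by auto
  have inj: "inj_on f (span (D - B))"
  proof (rule inj_onI)
    fix x y assume xy: "x \<in> span (D - B)" "y \<in> span (D - B)" "f x = f y"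
    then have d: "x - y \<in> span (D - B)" by (intro span_diff)
    moreover have "f (x - y) = 0" using xy linear_diff[OF f] by simp
    ultimately have "x - y \<in> span B" using DS by (auto simp: spanB K_def)
    with d disj have "x - y = 0" by blast
    then show "x = y" by simp
  qed
  have "f ` S = f ` span (D - B)"
  proof (intro antisym image_subsetI)
    fix x assume "x \<in> S"
    then obtain y z where x: "x = y + z" "y \<in> K" "z \<in> span (D - B)"
      using span_Un[of B "D - B"] unfolding BD spanB spanD by blast
    then have "f x = f z" using linear_add[OF f] by (simp add: K_def)
    then show "f x \<in> f ` span (D - B)" using x(3) by blast
  qed (use DS in blast)
  then have "dim (f ` S) = dim (f ` (D - B))" using linear_span_image[OF f] by (metis dim_span)
  also have "\<dots> = dim (D - B)" by (rule dim_image_eq[OF f inj])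
  also have "\<dots> = card (D - B)" by (rule dim_eq_card_independent) (rule independent_mono[OF D(3)], blast)
  also have "\<dots> = card D - card B"
    using card_Diff_subset[OF finite_subset[OF D(1)] D(1)] independent_imp_finite[OF D(3)] by blast
  also have "\<dots> = dim S - dim K" using B(4) basis_card_eq_dim[OF D(2,4,3)] by simp
  finally show ?thesis using dim_subset[of K S] by (auto simp: K_def)
qed

text \<open>If some operator is not scalar, one of the kernel and the range of its shift by an eigenvalue is
  again an invariant subspace of odd dimension.\<close>

lemma odd_dim_common_eigenvector:
  fixes T :: "'i \<Rightarrow> 'a::euclidean_space \<Rightarrow> 'a"
  assumes T: "\<And>i. linear (T i)" and S: "subspace S" and inv: "\<And>i. T i ` S \<subseteq> S" and odd: "odd (dim S)"
    and comm: "\<And>i j v. v \<in> S \<Longrightarrow> T i (T j v) = T j (T i v)"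
  shows "\<exists>v\<in>S. v \<noteq> 0 \<and> (\<forall>i. \<exists>r. T i v = r *\<^sub>R v)"
  using S inv odd comm
proof (induction "dim S" arbitrary: S rule: less_induct)
  case less
  note S = less.prems(1) and inv = less.prems(2) and odd = less.prems(3) and comm = less.prems(4)
  show ?case
  proof (cases "\<forall>i. \<exists>r. \<forall>v\<in>S. T i v = r *\<^sub>R v")
    case True
    have "S \<noteq> {0}" using odd by auto
    then obtain v where "v \<in> S" "v \<noteq> 0" using subspace_0[OF S] by blast
    with True show ?thesis by blast
  next
    case False
    then obtain i where i: "\<not> (\<exists>r. \<forall>v\<in>S. T i v = r *\<^sub>R v)" by blast
    obtain r u where u: "u \<in> S" "u \<noteq> 0" "T i u = r *\<^sub>R u"
      using odd_dim_eigenvector[OF T S inv odd] by blast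
    define f where "f v = T i v - r *\<^sub>R v" for v
    have f: "linear f" unfolding f_def by (intro linear_compose_sub T linear_compose_scale_right linear_id[unfolded id_def])
    define K where "K = {v \<in> S. f v = 0}"
    have K: "subspace K"
      unfolding K_def using subspace_inter[OF S linear_subspace_kernel[OF f]] by (simp add: Int_def)
    have R: "subspace (f ` S)" by (rule linear_subspace_image[OF f S])
    have KS: "K \<subseteq> S" by (auto simp: K_def)
    have RS: "f ` S \<subseteq> S"
      using inv by (auto simp: f_def intro!: subspace_diff[OF S] subspace_scale[OF S])
    have commf: "T j (f v) = f (T j v)" if "v \<in> S" for j v
      using comm[OF that] by (simp add: f_def linear_diff[OF T] linear_scale[OF T])
    have invK: "T j ` K \<subseteq> K" for j
    proof
      fix w assume "w \<in> T j ` K"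
      then obtain v where v: "w = T j v" "v \<in> S" "f v = 0" by (auto simp: K_def)
      then have "f w = 0" using commf[of v j] linear_0[OF T] by metis
      then show "w \<in> K" using v inv by (auto simp: K_def)
    qed
    have invR: "T j ` f ` S \<subseteq> f ` S" for j
      using commf inv by force
    \<comment> \<open>The kernel is proper because \<open>T i\<close> is not scalar on
      \<open>S\<close>; the range is proper because the eigenvector \<open>u\<close> lies in the
      kernel.\<close>
    have "dim K < dim S"
    proof (rule ccontr)
      assume "\<not> dim K < dim S"
      then have "K = S" using subspace_dim_equal[OF K S KS] by simp
      then have "\<forall>v\<in>S. T i v = r *\<^sub>R v" by (auto simp: K_def f_def)
      with i show False by blast
    qed
    moreover have dims: "dim (f ` S) + dim K = dim S"
      unfolding K_def by (rule dim_image_add_dim_kernel[OF f S])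
    moreover have "dim K \<noteq> 0" using u by (auto simp: K_def f_def)
    moreover have "odd (dim K) \<or> odd (dim (f ` S))" using dims odd by (metis even_add)
    ultimately consider "dim K < dim S" "odd (dim K)" | "dim (f ` S) < dim S" "odd (dim (f ` S))"
      by linarith
    then show ?thesis
    proof cases
      case 1
      then show ?thesis using less.hyps[OF 1(1) K invK 1(2)] comm KS by blast
    next
      case 2
      then show ?thesis using less.hyps[OF 2(1) R invR 2(2)] comm RS by blast
    qed
  qed
qed

section \<open>Parity of the number of simple real zeros\<close>

text \<open>A product of affine factors, one for each point of \<open>Z\<close>, each in a
  coordinate that separates this point from \<open>p\<close>.\<close>

lemma lagrange_poly:
  fixes p :: "real ^ 'n"
  assumes "finite Z" "p \<notin> Z"
  shows "\<exists>g. eval_poly g p = 1 \<and> (\<forall>z\<in>Z. eval_poly g z = 0)"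
  using assms
proof (induction Z)
  case empty
  then show ?case by (intro exI[of _ 1]) simp
next
  case (insert a Z)
  then obtain g where g: "eval_poly g p = 1" "\<forall>z\<in>Z. eval_poly g z = 0" by blast
  have "p \<noteq> a" using insert by auto
  then have "\<exists>i. p $ i \<noteq> a $ i" by (metis vec_eq_iff)
  then obtain i where i: "p $ i \<noteq> a $ i" ..
  define h where "h = Const (1 / (p $ i - a $ i)) * (Var i - Const (a $ i)) * g"
  have "eval_poly h p = 1" "\<forall>z\<in>insert a Z. eval_poly h z = 0"
    using i g by (auto simp: h_def)
  then show ?case by blast
qed

text \<open>Sums and the Leibniz rule determine \<delta> from its values on the variables, which
  form the tangent vector on the right-hand side.\<close>

lemma point_derivation_eq:
  fixes \<delta> :: "'n::finite rpoly \<Rightarrow> real"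
  assumes add: "\<And>f g. \<delta> (f + g) = \<delta> f + \<delta> g" and const: "\<And>c. \<delta> (Const c) = 0"
    and leibniz: "\<And>f g. \<delta> (f * g) = eval_poly f r * \<delta> g + eval_poly g r * \<delta> f"
  shows "\<delta> f = gradient (eval_poly f) r \<bullet> (\<chi> l. \<delta> (Var l))"
proof (induction f rule: rpoly_induct)
  case (Const c)
  then show ?case unfolding gradient_eval_Const by (simp add: const)
next
  case (add p q)
  then show ?case unfolding gradient_eval_add by (simp add: assms(1) inner_add_left)
next
  case (Var i p)
  then show ?case unfolding gradient_eval_mult by (simp add: leibniz inner_add_left inner_axis')
qed

lemma subspace_projection:
  fixes K :: "'a::euclidean_space set"
  assumes K: "subspace K"
  obtains P where "linear P" "\<And>x. P x \<in> K" "\<And>x v. v \<in> K \<Longrightarrow> P x \<bullet> v = x \<bullet> v"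
proof -
  obtain B where B: "B \<subseteq> K" "pairwise orthogonal B" "\<And>x. x \<in> B \<Longrightarrow> norm x = 1" "independent B" "span B = K"
    using orthonormal_basis_subspace[OF K] by metis
  have finB: "finite B" using B(4) by (rule independent_imp_finite)
  define P where "P x = (\<Sum>b\<in>B. (b \<bullet> x) *\<^sub>R b)" for x
  have P: "linear P"
    by (intro linearI) (simp_all add: P_def inner_add_right scaleR_add_left sum.distrib scaleR_sum_right)
  have "P c = c" if c: "c \<in> B" for c
  proof -
    have "P c = (\<Sum>b\<in>B. if b = c then c else 0)"
      unfolding P_def
      using B(2,3) c by (intro sum.cong refl) (auto simp: pairwise_def orthogonal_def norm_eq_1 dest: bspec)
    then show ?thesis using finB c by simp
  qed
  then have id: "P v = v" if "v \<in> K" for v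
    using linear_eq_on_span[OF P linear_id, of B v] that B(5) by simp
  show ?thesis
  proof
    show "linear P" by fact
    show "P x \<in> K" for x
      unfolding P_def using B(1) by (intro subspace_sum[OF K] subspace_scale[OF K]) auto
    show "P x \<bullet> v = x \<bullet> v" if "v \<in> K" for x v
    proof -
      have "P x \<bullet> v = x \<bullet> P v"
        by (simp add: P_def inner_sum_left inner_sum_right inner_commute mult.commute)
      then show ?thesis using id[OF that] by simp
    qed
  qed
qed

lemma mult_in_ideal_gen: "f * F i \<in> ideal_gen (range (F :: 'n::finite \<Rightarrow> 'n rpoly))"
proof -
  have "f * F i = (\<Sum>j\<in>UNIV. (if j = i then f else 0) * F j)"
    by (simp add: if_distrib[of "\<lambda>x. x * _"] cong: if_cong)
  then show ?thesis
    unfolding ideal_gen_image[OF finite] by (intro CollectI exI[of _ "\<lambda>j. if j = i then f else 0"]) simp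
qed

lemma eval_poly_ideal_gen:
  fixes F :: "'n::finite \<Rightarrow> 'n rpoly"
  assumes "f \<in> ideal_gen (range F)" "\<And>i. eval_poly (F i) z = 0"
  shows "eval_poly f z = 0"
  using assms by (auto simp: ideal_gen_image)

text \<open>Evaluation at the zeros factors through the quotient and, by Lagrange interpolation, is
  onto the functions on \<open>Z\<close>. The image of the polynomials vanishing on \<open>Z\<close>
  is its kernel.\<close>

lemma vanishing_codim:
  fixes F :: "'n::finite \<Rightarrow> 'n rpoly" and \<pi> :: "'n rpoly \<Rightarrow> 'a::euclidean_space"
  assumes \<pi>: "linear \<pi>" "surj \<pi>" and ker: "\<And>f. \<pi> f = 0 \<longleftrightarrow> f \<in> ideal_gen (range F)"
    and Z: "finite Z" "\<And>z i. z \<in> Z \<Longrightarrow> eval_poly (F i) z = 0"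
  shows "dim (\<pi> ` {f. \<forall>z\<in>Z. eval_poly f z = 0}) + card Z = DIM('a)"
proof -
  let ?V = "{f. \<forall>z\<in>Z. eval_poly f z = 0}"
  obtain \<sigma> where \<sigma>: "\<And>v. \<pi> (\<sigma> v) = v"
    using surj_f_inv_f[OF \<pi>(2)] by blast
  \<comment> \<open>The section \<open>\<sigma>\<close> need not be linear; \<open>ev z\<close> is
    linear because two lifts differ by an ideal element, which vanishes at \<open>z\<close>.\<close>
  define ev where "ev z v = eval_poly (\<sigma> v) z" for z v
  have ev: "ev z (\<pi> f) = eval_poly f z" if "z \<in> Z" for z f
  proof -
    have "\<pi> (\<sigma> (\<pi> f) - f) = 0"
      using linear_diff[OF \<pi>(1)] \<sigma> by simp
    then have "eval_poly (\<sigma> (\<pi> f) - f) z = 0"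
      using eval_poly_ideal_gen[of _ F z] Z(2)[OF that] ker by blast
    then show ?thesis by (simp add: ev_def)
  qed
  have lin_ev: "linear (ev z)" if "z \<in> Z" for z
  proof (rule linearI)
    show "ev z (x + y) = ev z x + ev z y" for x y
      using ev[OF that, of "\<sigma> x + \<sigma> y"]
      by (simp add: linear_add[OF \<pi>(1)] \<sigma> ev_def)
    show "ev z (c *\<^sub>R x) = c *\<^sub>R ev z x" for c x
      using ev[OF that, of "c *\<^sub>R \<sigma> x"]
      by (simp add: linear_scale[OF \<pi>(1)] \<sigma> ev_def)
  qed
  have "\<exists>g. \<forall>z\<in>Z. eval_poly (g z) z = 1 \<and> (\<forall>y\<in>Z - {z}. eval_poly (g z) y = 0)"
    using lagrange_poly[OF finite_Diff[OF Z(1)], of _ "{_}"] by (intro bchoice) blast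
  then obtain g where g: "\<And>z. z \<in> Z \<Longrightarrow> eval_poly (g z) z = 1"
      "\<And>y z. z \<in> Z \<Longrightarrow> y \<in> Z \<Longrightarrow> y \<noteq> z \<Longrightarrow> eval_poly (g z) y = 0"
    by blast
  define B where "B = (\<lambda>z. \<pi> (g z)) ` Z"
  have inj: "inj_on (\<lambda>z. \<pi> (g z)) Z"
    by (rule inj_onI) (metis ev g zero_neq_one)
  have indB: "independent B"
    unfolding dependent_def
  proof clarify
    fix b assume b: "b \<in> B" "b \<in> span (B - {b})"
    then obtain z where z: "z \<in> Z" "b = \<pi> (g z)" by (auto simp: B_def)
    have "span (B - {b}) \<subseteq> {v. ev z v = 0}"
    proof (rule span_minimal)
      show "subspace {v. ev z v = 0}" using linear_subspace_kernel[OF lin_ev[OF z(1)]] .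
      show "B - {b} \<subseteq> {v. ev z v = 0}"
      proof
        fix x assume "x \<in> B - {b}"
        then obtain y where y: "y \<in> Z" "x = \<pi> (g y)" "y \<noteq> z" using z by (auto simp: B_def)
        then show "x \<in> {v. ev z v = 0}" using g(2)[of y z] z(1) by (simp add: ev)
      qed
    qed
    then show False using b(2) z g(1) ev by auto
  qed
  \<comment> \<open>Evaluation at all points of \<open>Z\<close>, written inside the quotient
    itself: \<open>E\<close> projects onto the span of the Lagrange elements.\<close>
  define E where "E v = (\<Sum>z\<in>Z. ev z v *\<^sub>R \<pi> (g z))" for v
  have E: "linear E"
    unfolding E_def using lin_ev by (intro linear_compose_sum ballI) (simp add: linear_iff scaleR_add_left)
  have "E (\<pi> (g y)) = \<pi> (g y)" if "y \<in> Z" for y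
  proof -
    have "E (\<pi> (g y)) = (\<Sum>z\<in>Z. if z = y then \<pi> (g y) else 0)"
      unfolding E_def using that g by (intro sum.cong refl) (auto simp: ev)
    then show ?thesis using Z(1) that by simp
  qed
  then have "B \<subseteq> range E" unfolding B_def by (metis image_subsetI rangeI)
  moreover have "range E \<subseteq> span B"
    unfolding E_def B_def by (auto intro!: span_sum span_scale intro: span_base)
  ultimately have "span B = range E"
    using linear_subspace_image[OF E subspace_UNIV] by (metis span_minimal subset_antisym)
  then have "dim (range E) = card Z"
    using dim_span_eq_card_independent[OF indB] card_image[OF inj] by (simp add: B_def)
  moreover have "{v \<in> UNIV. E v = 0} = \<pi> ` ?V"
  proof (intro antisym subsetI)
    fix v assume "v \<in> {v \<in> UNIV. E v = 0}"
    then have "E v = 0" by simp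
    obtain f where f: "v = \<pi> f" using \<pi>(2) by blast
    have "eval_poly f y = 0" if y: "y \<in> Z" for y
    proof -
      have "0 = ev y (E v)" using \<open>E v = 0\<close> linear_0[OF lin_ev[OF y]] by simp
      also have "\<dots> = (\<Sum>z\<in>Z. if z = y then ev y v else 0)"
        unfolding E_def linear_sum[OF lin_ev[OF y]] linear_scale[OF lin_ev[OF y]]
        using y g by (intro sum.cong refl) (auto simp: ev)
      finally show ?thesis using y Z(1) by (simp add: f ev)
    qed
    then show "v \<in> \<pi> ` ?V" using f by blast
  next
    fix v assume "v \<in> \<pi> ` ?V"
    then show "v \<in> {v \<in> UNIV. E v = 0}" by (auto simp: E_def ev)
  qed
  ultimately show ?thesis
    using dim_image_add_dim_kernel[OF E subspace_UNIV] by simp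
qed

lemma card_zeros_parity:
  fixes F :: "'n::finite \<Rightarrow> 'n rpoly" and \<pi> :: "'n rpoly \<Rightarrow> 'a::euclidean_space"
  assumes \<pi>: "linear \<pi>" "surj \<pi>" and ker: "\<And>f. \<pi> f = 0 \<longleftrightarrow> f \<in> ideal_gen (range F)"
    and Z: "finite Z" "\<And>z. z \<in> Z \<longleftrightarrow> (\<forall>i. eval_poly (F i) z = 0)"
    and simple: "\<And>z w. z \<in> Z \<Longrightarrow> (\<And>i. gradient (eval_poly (F i)) z \<bullet> w = 0) \<Longrightarrow> w = 0"
  shows "even (card Z) \<longleftrightarrow> even (DIM('a))"
proof (rule ccontr)
  define V where "V = {f. \<forall>z\<in>Z. eval_poly f z = 0}"
  define K where "K = \<pi> ` V"
  assume "\<not> ?thesis"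
  moreover have "dim K + card Z = DIM('a)"
    unfolding K_def V_def by (rule vanishing_codim[OF \<pi> ker Z(1)]) (use Z(2) in auto)
  ultimately have odd: "odd (dim K)" by (metis even_add)
  have V: "subspace V" by (auto simp: subspace_def V_def)
  have K: "subspace K" unfolding K_def by (rule linear_subspace_image[OF \<pi>(1) V])
  obtain \<sigma> where \<sigma>: "\<And>v. \<pi> (\<sigma> v) = v"
    using surj_f_inv_f[OF \<pi>(2)] by blast
  define T where "T l v = \<pi> (Var l * \<sigma> v)" for l v
  have T_\<pi>: "T l (\<pi> f) = \<pi> (Var l * f)" for l f
  proof -
    have "\<pi> (\<sigma> (\<pi> f) - f) = 0"
      using linear_diff[OF \<pi>(1)] \<sigma> by simp
    then obtain h where "\<sigma> (\<pi> f) - f = (\<Sum>i\<in>UNIV. h i * F i)"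
      using ker ideal_gen_image[of UNIV F] by auto
    then have "Var l * \<sigma> (\<pi> f) - Var l * f = (\<Sum>i\<in>UNIV. (Var l * h i) * F i)"
      by (metis (no_types, lifting) mult.assoc right_diff_distrib sum.cong sum_distrib_left)
    then have "Var l * \<sigma> (\<pi> f) - Var l * f \<in> ideal_gen (range F)"
      unfolding ideal_gen_image[OF finite] by (intro CollectI exI[of _ "\<lambda>i. Var l * h i"]) simp
    then have "\<pi> (Var l * \<sigma> (\<pi> f) - Var l * f) = 0" using ker by blast
    then show ?thesis by (simp add: T_def linear_diff[OF \<pi>(1)])
  qed
  have T: "linear (T l)" for l
  proof (rule linearI)
    show "T l (x + y) = T l x + T l y" for x y
      using T_\<pi>[of l "\<sigma> x + \<sigma> y"]
      by (simp add: linear_add[OF \<pi>(1)] \<sigma> T_def distrib_left)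
    show "T l (c *\<^sub>R x) = c *\<^sub>R T l x" for c x
      using T_\<pi>[of l "c *\<^sub>R \<sigma> x"]
      by (simp add: linear_scale[OF \<pi>(1)] \<sigma> T_def)
  qed
  have TK: "T l v \<in> K" if "v \<in> K" for l v
    using that T_\<pi> by (force simp: K_def V_def)
  have T_comm: "T i (T j v) = T j (T i v)" for i j v
  proof -
    obtain f where "v = \<pi> f" using \<pi>(2) by blast
    then show ?thesis by (simp add: T_\<pi> mult.left_commute)
  qed
  obtain P where P: "linear P" "\<And>x. P x \<in> K" "\<And>x v. v \<in> K \<Longrightarrow> P x \<bullet> v = x \<bullet> v"
    using subspace_projection[OF K] by blast
  \<comment> \<open>The adjoints of the \<open>T l\<close> need not preserve \<open>K\<close>.
    Followed by the orthogonal projection, they give the transpose of the restriction of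
    \<open>T l\<close> to \<open>K\<close>.\<close>
  define S where "S l u = P (adjoint (T l) u)" for l u
  have S_inner: "S l u \<bullet> v = u \<bullet> T l v" if "v \<in> K" for l u v
    using P(3)[OF that] adjoint_works[OF T, of v l u] by (simp add: S_def inner_commute)
  have "\<exists>u\<in>K. u \<noteq> 0 \<and> (\<forall>l. \<exists>r. S l u = r *\<^sub>R u)"
  proof (rule odd_dim_common_eigenvector[OF _ K _ odd])
    show "linear (S l)" for l
      unfolding S_def using linear_compose[OF adjoint_linear[OF T] P(1)] by (simp add: o_def)
    show "S l ` K \<subseteq> K" for l using P(2) by (auto simp: S_def)
    fix i j u assume "u \<in> K"
    \<comment> \<open>Since \<open>S_inner\<close> controls inner products with elements of
      \<open>K\<close> only, the commutator is tested against itself.\<close>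
    let ?w = "S i (S j u) - S j (S i u)"
    have w: "?w \<in> K" using P(2) by (intro subspace_diff[OF K]) (simp_all add: S_def)
    have "S i (S j u) \<bullet> ?w = S j (S i u) \<bullet> ?w"
      using S_inner[OF w] S_inner[OF TK[OF w]] T_comm by simp
    then have "?w \<bullet> ?w = 0" by (subst inner_diff_left) simp
    then show "S i (S j u) = S j (S i u)" by simp
  qed
  then obtain u r where u: "u \<in> K" "u \<noteq> 0" and r: "\<And>l. S l u = r l *\<^sub>R u" by metis
  define y where "y = (\<chi> l. r l)"
  define \<phi> where "\<phi> f = u \<bullet> \<pi> f" for f
  have \<phi>_add: "\<phi> (f + g) = \<phi> f + \<phi> g" and \<phi>_scale: "\<phi> (c *\<^sub>R f) = c * \<phi> f" for c f g
    by (simp_all add: \<phi>_def linear_add[OF \<pi>(1)] linear_scale[OF \<pi>(1)] inner_add_right)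
  have V_mult: "g * f \<in> V" if "f \<in> V" for f g using that by (simp add: V_def)
  \<comment> \<open>The restriction to \<open>V\<close> keeps the classes in \<open>K\<close>, where
    \<open>S l\<close> is transposed to multiplication by the variable and the eigenvalue can be
    pulled out.\<close>
  have \<phi>_mult: "\<phi> (g * f) = eval_poly g y * \<phi> f" if f: "f \<in> V" for f g
  proof (induction g rule: rpoly_induct)
    case (Const c)
    then show ?case by (simp add: Const_times_eq_scaleR \<phi>_scale)
  next
    case (add p q)
    then show ?case by (simp add: distrib_right \<phi>_add)
  next
    case (Var i p)
    have "p * f \<in> V" using V_mult f by blast
    then have "\<pi> (p * f) \<in> K" by (simp add: K_def)
    then have "\<phi> (Var i * (p * f)) = r i * \<phi> (p * f)"
      using S_inner[of "\<pi> (p * f)" i u] r[of i] by (simp add: \<phi>_def T_\<pi>)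
    then show ?case using Var by (simp add: mult.assoc y_def)
  qed
  have \<phi>_ideal: "\<phi> (f * F i) = 0" for f i
    using mult_in_ideal_gen[of f F i] ker[of "f * F i"] by (simp add: \<phi>_def)
  \<comment> \<open>A lift of \<open>u\<close> itself: \<phi> takes the value
    \<open>u \<bullet> u\<close> there, so \<phi> does not vanish on \<open>V\<close>.\<close>
  obtain f0 where f0: "f0 \<in> V" "u = \<pi> f0" using u by (auto simp: K_def)
  have \<phi>f0: "\<phi> f0 \<noteq> 0" using u(2) f0(2) by (simp add: \<phi>_def)
  have "eval_poly (F i) y = 0" for i
    using \<phi>_mult[OF f0(1), of "F i"] \<phi>_ideal[of f0 i] \<phi>f0 by (simp add: mult.commute)
  then have yZ: "y \<in> Z" using Z(2) by blast
  obtain g where g: "eval_poly g y = 1" "\<forall>z\<in>Z - {y}. eval_poly g z = 0"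
    using lagrange_poly[of "Z - {y}" y] Z(1) by auto
  \<comment> \<open>The factor \<open>g\<close>, equal to 1 at \<open>y\<close> and to 0 at the
    other zeros, brings f - f(y) into \<open>V\<close>, where \<open>\<phi>_mult\<close>
    applies.\<close>
  define \<delta> where "\<delta> f = \<phi> (g * (f - Const (eval_poly f y)))" for f
  have gV: "g * (f - Const (eval_poly f y)) \<in> V" for f using g by (auto simp: V_def)
  have \<delta>: "\<delta> f = gradient (eval_poly f) y \<bullet> (\<chi> l. \<delta> (Var l))" for f
  proof (rule point_derivation_eq)
    show "\<delta> (f + h) = \<delta> f + \<delta> h" for f h
    proof -
      have "g * (f + h - Const (eval_poly (f + h) y))
          = g * (f - Const (eval_poly f y)) + g * (h - Const (eval_poly h y))"
        by (simp add: Const_eq_scaleR_1 scaleR_add_left algebra_simps)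
      then show ?thesis by (simp add: \<delta>_def \<phi>_add)
    qed
    show "\<delta> (Const c) = 0" for c by (simp add: \<delta>_def) (simp add: \<phi>_def linear_0[OF \<pi>(1)])
    show "\<delta> (f * h) = eval_poly f y * \<delta> h + eval_poly h y * \<delta> f" for f h
    proof -
      let ?a = "f - Const (eval_poly f y)" and ?b = "h - Const (eval_poly h y)"
      have "g * (f * h - Const (eval_poly (f * h) y))
          = ?a * (g * ?b) + eval_poly f y *\<^sub>R (g * ?b) + eval_poly h y *\<^sub>R (g * ?a)"
        by (simp add: Const_eq_scaleR_1 algebra_simps)
      then have "\<delta> (f * h) = \<phi> (?a * (g * ?b)) + eval_poly f y * \<delta> h + eval_poly h y * \<delta> f"
        by (simp add: \<delta>_def \<phi>_add \<phi>_scale)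
      \<comment> \<open>The factor \<open>?a\<close> vanishes at \<open>y\<close> and is pulled out
        as its value there.\<close>
      moreover have "\<phi> (?a * (g * ?b)) = 0" by (subst \<phi>_mult[OF gV]) simp
      ultimately show ?thesis by simp
    qed
  qed
  \<comment> \<open>The tangent vector of \<delta> is thus orthogonal to all gradients at the simple
    zero \<open>y\<close>, which makes \<delta> zero; yet \<delta> and \<phi> agree on
    \<open>f0\<close>.\<close>
  have "\<delta> (F i) = 0" for i
    using \<phi>_ideal[of g i] \<open>eval_poly (F i) y = 0\<close> by (simp add: \<delta>_def)
  then have "(\<chi> l. \<delta> (Var l)) = 0" using simple[OF yZ] \<delta> by metis
  then have "\<delta> f0 = 0" using \<delta>[of f0] by simp
  moreover have "\<delta> f0 = \<phi> f0"
    using f0(1) yZ \<phi>_mult[OF f0(1), of g] g(1) by (simp add: \<delta>_def V_def)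
  ultimately show False using \<phi>f0 by simp
qed

section \<open>Perturbation to a regular value\<close>

text \<open>\<open>baby_Sard\<close> is stated for well-ordered index types only; this copy of a finite linear order is one.\<close>

typedef 'a wellordered = "UNIV :: 'a set"
  by simp

instance wellordered :: (finite) finite
proof
  have "(UNIV :: 'a wellordered set) = range Abs_wellordered"
    by (rule type_definition.Abs_image[OF type_definition_wellordered, symmetric])
  then show "finite (UNIV :: 'a wellordered set)" using finite_imageI[OF finite] by metis
qed

instantiation wellordered :: ("{finite, linorder}") linorder
begin

definition "x \<le> y \<longleftrightarrow> Rep_wellordered x \<le> Rep_wellordered y"
definition "x < y \<longleftrightarrow> Rep_wellordered x < Rep_wellordered y"

instance
  by standard (auto simp: less_eq_wellordered_def less_wellordered_def Rep_wellordered_inject[symmetric])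

end

instance wellordered :: ("{finite, linorder}") wellorder
proof
  fix P :: "'a wellordered \<Rightarrow> bool" and a
  assume step: "\<And>x. (\<And>y. y < x \<Longrightarrow> P y) \<Longrightarrow> P x"
  show "P a"
  proof (induction "card {..<a}" arbitrary: a rule: less_induct)
    case less
    show ?case
    proof (rule step)
      fix y assume "y < a"
      then have "{..<y} \<subset> {..<a}" by auto
      then show "P y" using less[of y] psubset_card_mono[of "{..<a}"] by simp
    qed
  qed
qed

lemma card_wellordered: "CARD('a wellordered) = CARD('a)"
  by (rule type_definition.card[OF type_definition_wellordered])

text \<open>Relabelling the coordinates conjugates \<open>f\<close> to a map to which Sard's theorem
  applies; the linear relabelling back preserves null sets and singularity of the
  derivative.\<close>

lemma negligible_critical_values:
  fixes f :: "real ^ 'n::{finite,linorder} \<Rightarrow> real ^ 'n::{finite,linorder}"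
  assumes f: "\<And>x. (f has_derivative f' x) (at x)"
  shows "negligible (f ` {x. \<not> inj (f' x)})"
proof -
  define R where "R x = (\<chi> i. x $ Rep_wellordered i)" for x :: "real ^ 'n::{finite,linorder}"
  define A where "A y = (\<chi> i. y $ Abs_wellordered i)" for y :: "real ^ ('n::{finite,linorder}) wellordered"
  have R: "linear R" and A: "linear A"
    by (auto intro!: linearI simp: R_def A_def vec_eq_iff)
  have AR [simp]: "A (R x) = x" and RA [simp]: "R (A y) = y" for x y
    by (simp_all add: A_def R_def Rep_wellordered_inverse Abs_wellordered_inverse vec_eq_iff)
  note R' = linear_imp_has_derivative[OF R] and A' = linear_imp_has_derivative[OF A]
  have g: "((\<lambda>y. R (f (A y))) has_derivative (\<lambda>h. R (f' (A y) (A h)))) (at y)" for y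
    by (rule has_derivative_compose[OF has_derivative_compose[OF A' f] R'])
  have lin: "linear (\<lambda>h. R (f' (A y) (A h)))" for y
    using has_derivative_linear[OF g] .
  let ?S = "{y. \<not> inj (f' (A y))}"
  have "negligible ((\<lambda>y. R (f (A y))) ` ?S)"
  proof (rule baby_Sard[OF order_refl has_derivative_at_withinI[OF g]])
    fix y assume "y \<in> ?S"
    then have "\<not> inj (f' (A y))" by simp
    then have "\<not> inj (\<lambda>h. R (f' (A y) (A h)))"
      unfolding inj_def by (metis AR RA)
    moreover have "(*v) (matrix (\<lambda>h. R (f' (A y) (A h)))) = (\<lambda>h. R (f' (A y) (A h)))"
      using matrix_works[of "\<lambda>h. R (f' (A y) (A h))"] lin by (auto simp: linear_matrix_vector_mul_eq)
    ultimately show "rank (matrix (\<lambda>h. R (f' (A y) (A h)))) < CARD('n wellordered)"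
      by (simp add: less_rank_noninjective)
  qed
  then have "negligible (A ` (\<lambda>y. R (f (A y))) ` ?S)"
    by (rule negligible_differentiable_image_negligible[rotated])
      (simp_all add: card_wellordered linear_imp_differentiable_on[OF A])
  moreover have "A ` (\<lambda>y. R (f (A y))) ` ?S = f ` {x. \<not> inj (f' x)}"
    by (auto simp: image_iff) (metis AR)
  ultimately show ?thesis by simp
qed

lemma finite_separated:
  fixes Z :: "'a::metric_space set"
  assumes "finite Z"
  obtains r where "r > 0" "\<And>x y. x \<in> Z \<Longrightarrow> y \<in> Z \<Longrightarrow> x \<noteq> y \<Longrightarrow> ball x r \<inter> ball y r = {}"
proof -
  \<comment> \<open>The extra element 1 keeps the minimum meaningful when no two distinct points
    exist.\<close>
  define D where "D = insert 1 ((\<lambda>(x, y). dist x y) ` (Z \<times> Z - Id))"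
  have D: "finite D" "D \<noteq> {}" using assms by (auto simp: D_def)
  define r where "r = Min D / 2"
  have "r > 0" using D by (auto simp: r_def Min_gr_iff) (auto simp: D_def)
  moreover have "ball x r \<inter> ball y r = {}" if "x \<in> Z" "y \<in> Z" "x \<noteq> y" for x y
  proof -
    have "dist x y \<in> D" using that by (force simp: D_def)
    then have "2 * r \<le> dist x y" using D by (simp add: r_def)
    then show ?thesis by (intro disjoint_ballI) simp
  qed
  ultimately show ?thesis by (rule that)
qed

text \<open>By the open mapping property at nondegenerate zeros, the images of small disjoint balls
  all contain a common neighbourhood of 0. It is not a null set, hence contains a regular value
  \<open>v\<close>, and each ball contributes its own preimage of \<open>v\<close>.\<close>

lemma regular_value_perturbation:
  fixes f :: "real ^ 'n::{finite,linorder} \<Rightarrow> real ^ 'n::{finite,linorder}"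
  assumes f: "\<And>x. (f has_derivative f' x) (at x)"
    and Z: "finite Z" "\<And>z. z \<in> Z \<Longrightarrow> f z = 0" "\<And>z. z \<in> Z \<Longrightarrow> inj (f' z)"
  obtains v W where "\<And>w. w \<in> W \<Longrightarrow> f w = v" "finite W" "card W = card Z"
    "\<And>y. f y = v \<Longrightarrow> inj (f' y)"
proof -
  obtain r where r: "r > 0" "\<And>x y. x \<in> Z \<Longrightarrow> y \<in> Z \<Longrightarrow> x \<noteq> y \<Longrightarrow> ball x r \<inter> ball y r = {}"
    using finite_separated[OF Z(1)] by metis
  have cont: "continuous_on UNIV f"
    using f by (meson continuous_at_imp_continuous_on has_derivative_continuous)
  define U where "U = (\<Inter>z\<in>Z. interior (f ` ball z r))"
  have "0 \<in> interior (f ` ball z r)" if z: "z \<in> Z" for z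
  proof -
    have lin: "linear (f' z)" using has_derivative_linear[OF f] .
    then obtain g where g: "linear g" "f' z \<circ> g = id"
      using linear_injective_imp_surjective[OF lin Z(3)[OF z]] linear_surjective_right_inverse by blast
    have "f z \<in> interior (f ` ball z r)"
      by (rule sussmann_open_mapping[OF open_UNIV cont UNIV_I f _ g(2)])
        (use g(1) r(1) in \<open>auto simp: linear_conv_bounded_linear\<close>)
    then show ?thesis using Z(2)[OF z] by simp
  qed
  then have "0 \<in> U" by (simp add: U_def)
  moreover have "open U" unfolding U_def using Z(1) by blast
  ultimately have "\<not> negligible U" using open_not_negligible by blast
  then obtain v where v: "v \<in> U" "v \<notin> f ` {x. \<not> inj (f' x)}"
    using negligible_critical_values[OF f] negligible_subset by blast
  have "\<exists>y. y \<in> ball z r \<and> f y = v" if "z \<in> Z" for z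
  proof -
    have "v \<in> interior (f ` ball z r)" using v(1) that by (simp add: U_def)
    then have "v \<in> f ` ball z r" using interior_subset by blast
    then show ?thesis by blast
  qed
  then obtain w where w: "\<And>z. z \<in> Z \<Longrightarrow> w z \<in> ball z r" "\<And>z. z \<in> Z \<Longrightarrow> f (w z) = v"
    by metis
  have "inj_on w Z"
    by (rule inj_onI) (metis IntI empty_iff r(2) w(1))
  then show ?thesis
    using that[of "w ` Z" v] w(2) v(2) Z(1) by (auto simp: card_image)
qed

section \<open>Generic points\<close>

text \<open>A coordinate-free substitute for polynomial functions, closed under the operations that
  build determinants and strong enough for genericity, which only looks at lines.\<close>

definition poly_on_lines :: "('a::real_vector \<Rightarrow> real) \<Rightarrow> bool" where
  "poly_on_lines f \<longleftrightarrow> (\<forall>x y. \<exists>p. \<forall>t. f (x + t *\<^sub>R y) = poly p t)"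

lemma poly_on_lines_const: "poly_on_lines (\<lambda>x. c)"
  unfolding poly_on_lines_def by (intro allI exI[of _ "[:c:]"]) simp

lemma poly_on_lines_linear:
  assumes "linear f"
  shows "poly_on_lines f"
  unfolding poly_on_lines_def
proof (intro allI)
  fix x y
  show "\<exists>p. \<forall>t. f (x + t *\<^sub>R y) = poly p t"
    by (intro exI[of _ "[:f x, f y:]"]) (simp add: linear_add[OF assms] linear_scale[OF assms])
qed

lemma poly_on_lines_add:
  assumes "poly_on_lines f" "poly_on_lines g"
  shows "poly_on_lines (\<lambda>x. f x + g x)"
  using assms unfolding poly_on_lines_def by (metis poly_add)

lemma poly_on_lines_mult:
  assumes "poly_on_lines f" "poly_on_lines g"
  shows "poly_on_lines (\<lambda>x. f x * g x)"
  using assms unfolding poly_on_lines_def by (metis poly_mult)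

lemma poly_on_lines_sum:
  "(\<And>i. i \<in> I \<Longrightarrow> poly_on_lines (f i)) \<Longrightarrow> poly_on_lines (\<lambda>x. \<Sum>i\<in>I. f i x)"
  by (induction I rule: infinite_finite_induct) (simp_all add: poly_on_lines_const poly_on_lines_add)

lemma poly_on_lines_prod:
  "(\<And>i. i \<in> I \<Longrightarrow> poly_on_lines (f i)) \<Longrightarrow> poly_on_lines (\<lambda>x. \<Prod>i\<in>I. f i x)"
  by (induction I rule: infinite_finite_induct) (simp_all add: poly_on_lines_const poly_on_lines_mult)

lemma poly_on_lines_power: "poly_on_lines f \<Longrightarrow> poly_on_lines (\<lambda>x. f x ^ n)"
  by (induction n) (simp_all add: poly_on_lines_const poly_on_lines_mult)

lemma poly_on_lines_eval_poly:
  assumes "linear h"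
  shows "poly_on_lines (\<lambda>x. eval_poly p (h x))"
proof -
  have "linear (\<lambda>x. h x $ i)" for i
    by (rule linearI) (simp_all add: linear_add[OF assms] linear_scale[OF assms])
  note power = poly_on_lines_power[OF poly_on_lines_linear[OF this]]
  show ?thesis
    unfolding eval_poly_def
    by (rule poly_on_lines_sum, rule poly_on_lines_mult[OF poly_on_lines_const poly_on_lines_prod[OF power]])
qed

lemma poly_on_lines_det:
  fixes A :: "'a::real_vector \<Rightarrow> real ^ 'n ^ 'n"
  assumes "\<And>i j. poly_on_lines (\<lambda>x. A x $ i $ j)"
  shows "poly_on_lines (\<lambda>x. det (A x))"
  unfolding Determinants.det_def
  by (intro poly_on_lines_sum poly_on_lines_mult[OF poly_on_lines_const] poly_on_lines_prod assms)

text \<open>Join a point good for the earlier functions to one good for \<open>f k\<close>. On this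
  line the product of the earlier functions and \<open>f k\<close> are nonzero univariate
  polynomials, so all but finitely many parameters serve both.\<close>

lemma poly_on_lines_common_nonzero:
  fixes f :: "'i \<Rightarrow> 'a::real_vector \<Rightarrow> real"
  assumes "finite I" "\<And>i. i \<in> I \<Longrightarrow> poly_on_lines (f i)" "\<And>i. i \<in> I \<Longrightarrow> \<exists>x. f i x \<noteq> 0"
  shows "\<exists>x. \<forall>i\<in>I. f i x \<noteq> 0"
  using assms
proof (induction I)
  case (insert k I)
  then obtain x where x: "\<forall>i\<in>I. f i x \<noteq> 0" by auto
  obtain y where y: "f k y \<noteq> 0" using insert.prems(2)[of k] by blast
  define g where "g z = (\<Prod>i\<in>I. f i z)" for z
  have "poly_on_lines g" unfolding g_def using insert by (intro poly_on_lines_prod) auto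
  then obtain p where p: "\<And>t. g (x + t *\<^sub>R (y - x)) = poly p t" unfolding poly_on_lines_def by blast
  have "poly_on_lines (f k)" using insert by auto
  then obtain q where q: "\<And>t. f k (x + t *\<^sub>R (y - x)) = poly q t" unfolding poly_on_lines_def by blast
  have "g x \<noteq> 0" using x insert(1) by (simp add: g_def)
  then have "poly p 0 \<noteq> 0" using p[of 0] by simp
  moreover have "poly q 1 \<noteq> 0" using q[of 1] y by simp
  ultimately have "p * q \<noteq> 0" by auto
  then have "finite {t. poly (p * q) t = 0}" by (rule poly_roots_finite)
  then obtain t where "poly (p * q) t \<noteq> 0"
    using infinite_UNIV_char_0 by (metis (mono_tags, lifting) UNIV_eq_I mem_Collect_eq)
  then have "g (x + t *\<^sub>R (y - x)) \<noteq> 0" "f k (x + t *\<^sub>R (y - x)) \<noteq> 0" by (auto simp: p q)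
  then show ?case using insert(1) by (intro exI[of _ "x + t *\<^sub>R (y - x)"]) (auto simp: g_def)
qed simp

section \<open>Nondegeneracy expressed by orthogonality\<close>

lemma det_nonzero_iff_rows:
  fixes A :: "real ^ 'n ^ 'n"
  shows "det A \<noteq> 0 \<longleftrightarrow> (\<forall>w. (\<forall>i. A $ i \<bullet> w = 0) \<longrightarrow> w = 0)"
proof -
  have "A *v w = 0 \<longleftrightarrow> (\<forall>i. A $ i \<bullet> w = 0)" for w
    by (simp add: vec_eq_iff matrix_vector_mult_def inner_vec_def)
  then show ?thesis
    using matrix_left_invertible_ker[of A] invertible_det_nz[of A] invertible_left_inverse[of A] by simp
qed

lemma orthogonal_trivial_imp_span:
  fixes S :: "'a::euclidean_space set"
  assumes "\<And>w. (\<And>x. x \<in> S \<Longrightarrow> x \<bullet> w = 0) \<Longrightarrow> w = 0"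
  shows "span S = UNIV"
proof (rule ccontr)
  assume "span S \<noteq> UNIV"
  then obtain a where "a \<noteq> 0" "\<forall>x\<in>span S. a \<bullet> x = 0" using span_not_UNIV_orthogonal by blast
  then show False using assms[of a] span_base by (metis inner_commute)
qed

lemma orthogonal_trivial_imp_independent:
  fixes g :: "'n::finite \<Rightarrow> real ^ 'n"
  assumes "\<And>w. (\<And>i. g i \<bullet> w = 0) \<Longrightarrow> w = 0"
  shows "inj g" "independent (range g)"
proof -
  have span: "span (range g) = UNIV" by (rule orthogonal_trivial_imp_span) (use assms in auto)
  then have "dim (range g) = CARD('n)" by (metis DIM_cart DIM_real dim_UNIV dim_span mult.right_neutral)
  moreover have "dim (range g) \<le> card (range g)" by (rule dim_le_card') simp
  ultimately have card: "card (range g) = CARD('n)" using card_image_le[of UNIV g] by simp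
  then show "inj g" by (simp add: eq_card_imp_inj_on)
  show "independent (range g)"
    by (rule card_le_dim_spanning[of _ UNIV]) (use span card in auto)
qed

lemma in_single_zerosI:
  assumes "\<And>i. eval_poly (Q i) y = 0" "\<And>w. (\<And>i. gradient (eval_poly (Q i)) y \<bullet> w = 0) \<Longrightarrow> w = 0"
  shows "y \<in> single_zeros Q"
  unfolding single_zeros_def
  using assms orthogonal_trivial_imp_independent[of "\<lambda>i. gradient (eval_poly (Q i)) y"] by auto

section \<open>Systems of quadratic equations\<close>

definition quad_form :: "('n::finite \<Rightarrow> 'n \<Rightarrow> real) \<Rightarrow> 'n rpoly" where
  "quad_form a = (\<Sum>j\<in>UNIV. \<Sum>l\<in>UNIV. Const (a j l) * Var j * Var l)"

lemma homogeneous_lookup: "homogeneous k p \<longleftrightarrow> (\<forall>m. mon_degree m \<noteq> k \<longrightarrow> Poly_Mapping.lookup p m = 0)"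
  unfolding homogeneous_def Ball_def in_keys_iff by metis

lemma homogeneous_quad_form: "homogeneous 2 (quad_form a)"
proof -
  have "homogeneous 2 (Const c * Var j * Var l)" for c and j l :: 'a
    by (auto simp: homogeneous_lookup Const_def Var_def mult_single lookup_single when_def mon_degree_add)
  then show ?thesis by (simp add: homogeneous_lookup quad_form_def lookup_sum)
qed

lemma eval_quad_form: "eval_poly (quad_form a) y = (\<Sum>j\<in>UNIV. \<Sum>l\<in>UNIV. a j l * y $ j * y $ l)"
  by (simp add: quad_form_def)

lemma eval_quad_form_minus: "eval_poly (quad_form a) (- y) = eval_poly (quad_form a) y"
  by (simp add: eval_quad_form)

lemma gradient_eval_sum:
  "gradient (eval_poly (\<Sum>i\<in>A. f i)) y = (\<Sum>i\<in>A. gradient (eval_poly (f i)) y)"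
proof (induction A rule: infinite_finite_induct)
  case (insert x A)
  show ?case unfolding sum.insert[OF insert(1,2)] gradient_eval_add insert(3) by (rule refl)
qed (simp_all only: not_False_eq_True sum.infinite sum.empty gradient_eval_Const[of 0 y, unfolded Const_0])

lemma eval_quad_form_plus:
  "eval_poly (quad_form a) (y + z)
     = eval_poly (quad_form a) y + gradient (eval_poly (quad_form a)) y \<bullet> z + eval_poly (quad_form a) z"
proof -
  have "gradient (eval_poly (Const c * Var j * Var l)) y \<bullet> z = c * (y $ j * z $ l + y $ l * z $ j)" for c j l
    unfolding gradient_eval_mult gradient_eval_Var gradient_eval_Const
    by (simp add: inner_add_left inner_axis' algebra_simps)
  then have "gradient (eval_poly (quad_form a)) y \<bullet> z = (\<Sum>j\<in>UNIV. \<Sum>l\<in>UNIV. a j l * (y $ j * z $ l + y $ l * z $ j))"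
    unfolding quad_form_def gradient_eval_sum inner_sum_left by simp
  then show ?thesis
    unfolding eval_quad_form by (simp add: sum.distrib[symmetric] algebra_simps)
qed

text \<open>The array \<open>a\<close> need not be symmetric, so vanishing values only make it
  antisymmetric; exchanging the summation indices then shows that the polynomial equals its
  negative.\<close>

lemma quad_form_eq_0:
  assumes "\<And>y. eval_poly (quad_form a) y = 0"
  shows "quad_form a = 0"
proof -
  have diag: "a j j = 0" for j
    using assms[of "axis j 1"] by (simp add: eval_quad_form axis_def if_distrib[of "\<lambda>x. _ * x"] if_distrib[of "\<lambda>x. x * _"] cong: if_cong)
  have anti: "a j l = - a l j" for j l
  proof (cases "j = l")
    case True
    then show ?thesis using diag by simp
  next
    case False
    have "eval_poly (quad_form a) (axis j 1 + axis l 1) = a j j + a j l + a l j + a l l"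
      by (simp add: eval_quad_form axis_def distrib_left distrib_right sum.distrib
          if_distrib[of "\<lambda>x. _ * x"] if_distrib[of "\<lambda>x. x * _"] cong: if_cong)
    then show ?thesis using assms diag by simp
  qed
  have "quad_form a = (\<Sum>l\<in>UNIV. \<Sum>j\<in>UNIV. Const (a j l) * Var j * Var l)"
    unfolding quad_form_def by (rule sum.swap)
  also have "\<dots> = (\<Sum>l\<in>UNIV. \<Sum>j\<in>UNIV. - (Const (a l j) * Var l * Var j))"
  proof (intro sum.cong refl)
    fix l j
    show "Const (a j l) * Var j * Var l = - (Const (a l j) * Var l * Var j)"
      using anti[of j l] by (simp add: Const_eq_scaleR_1 mult.commute)
  qed
  also have "\<dots> = - quad_form a" by (simp add: quad_form_def sum_negf)
  finally have "2 *\<^sub>R quad_form a = 0" by (simp add: scaleR_2 eq_neg_iff_add_eq_0)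
  then show ?thesis by simp
qed

lemma total_degree_le_iff: "total_degree p \<le> n \<longleftrightarrow> p \<in> deg_less (Suc n)"
  by (auto simp: total_degree_def deg_less_def less_Suc_eq_le)

lemma hom_part_homogeneous:
  assumes "homogeneous k p"
  shows "hom_part p = p"
\<comment> \<open>The zero polynomial is homogeneous of every degree but has total degree 0.\<close>
proof (cases "p = 0")
  case True
  then show ?thesis by (simp add: hom_part_def)
next
  case False
  then have "Poly_Mapping.keys p \<noteq> {}" by (metis poly_mapping_eqI not_in_keys_iff_lookup_eq_zero empty_iff lookup_zero)
  then obtain m where "m \<in> Poly_Mapping.keys p" by blast
  then have "mon_degree ` Poly_Mapping.keys p = {k}" using assms by (force simp: homogeneous_def)
  then have "total_degree p = k" by (simp add: total_degree_def)
  then have "{m. m \<in> Poly_Mapping.keys p \<and> mon_degree m = total_degree p} = Poly_Mapping.keys p"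
    using assms by (auto simp: homogeneous_def)
  then show ?thesis by (simp add: hom_part_def rpoly_as_sum[symmetric])
qed

lemma has_derivative_vec_eval:
  "((\<lambda>y. \<chi> i. eval_poly (F i) y) has_derivative (\<lambda>h. \<chi> i. gradient (eval_poly (F i)) y \<bullet> h)) (at y)"
  unfolding has_derivative_componentwise_within[where f = "\<lambda>y. \<chi> i. eval_poly (F i) y"]
  by (auto simp: Basis_vec_def inner_axis has_derivative_eval_poly)

section \<open>Bounding and counting the real zeros of a regular system\<close>

context quadratic_regular
begin

lemma DIM_vec_set: "DIM(real ^ ('n set)) = 2 ^ CARD('n)"
  using card_Pow[of "UNIV :: 'n set"] by simp

lemma card_zeros_le:
  assumes "finite Z" "\<And>z i. z \<in> Z \<Longrightarrow> eval_poly (F i) z = 0"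
  shows "card Z \<le> 2 ^ CARD('n)"
proof -
  obtain \<pi> :: "'n rpoly \<Rightarrow> real ^ ('n set)" where \<pi>: "linear \<pi>" "surj \<pi>"
    "\<And>f. \<pi> f = 0 \<longleftrightarrow> f \<in> ideal_gen (range F)"
    using quotient_map by blast
  have "dim (\<pi> ` {f. \<forall>z\<in>Z. eval_poly f z = 0}) + card Z = DIM(real ^ ('n set))"
    by (rule vanishing_codim[OF \<pi> assms])
  then show ?thesis unfolding DIM_vec_set by linarith
qed

lemma finite_zeros: "finite {y. \<forall>i. eval_poly (F i) y = 0}"
proof (rule ccontr)
  assume "infinite {y. \<forall>i. eval_poly (F i) y = 0}"
  then obtain Z where "finite Z" "card Z = Suc (2 ^ CARD('n))" "Z \<subseteq> {y. \<forall>i. eval_poly (F i) y = 0}"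
    using infinite_arbitrarily_large by blast
  then show False using card_zeros_le[of Z] by auto
qed

lemma ecard_single_zeros_le: "ecard (single_zeros F) \<le> enat (2 ^ CARD('n))"
proof -
  have "single_zeros F \<subseteq> {y. \<forall>i. eval_poly (F i) y = 0}" by (auto simp: single_zeros_def)
  then have "finite (single_zeros F)" using finite_zeros by (rule finite_subset)
  moreover from this have "card (single_zeros F) \<le> 2 ^ CARD('n)"
    by (rule card_zeros_le) (auto simp: single_zeros_def)
  ultimately show ?thesis by (simp add: ecard_def)
qed

text \<open>The dimension \<open>2 ^ CARD('n)\<close> is even because an index type is never
  empty.\<close>

lemma even_card_zeros:
  assumes "\<And>z w. (\<And>i. eval_poly (F i) z = 0) \<Longrightarrow> (\<And>i. gradient (eval_poly (F i)) z \<bullet> w = 0) \<Longrightarrow> w = 0"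
  shows "even (card {y. \<forall>i. eval_poly (F i) y = 0})"
proof -
  obtain \<pi> :: "'n rpoly \<Rightarrow> real ^ ('n set)" where \<pi>: "linear \<pi>" "surj \<pi>"
    "\<And>f. \<pi> f = 0 \<longleftrightarrow> f \<in> ideal_gen (range F)"
    using quotient_map by blast
  have "even (card {y. \<forall>i. eval_poly (F i) y = 0}) \<longleftrightarrow> even (DIM(real ^ ('n set)))"
    by (rule card_zeros_parity[OF \<pi> finite_zeros]) (use assms in auto)
  then show ?thesis unfolding DIM_vec_set by simp
qed

end

section \<open>Construction of a system with many simple zeros\<close>

locale regular_quadratic_forms =
  fixes a :: "'n::{finite,linorder} \<Rightarrow> 'n \<Rightarrow> 'n \<Rightarrow> real" and q :: "'n \<Rightarrow> 'n rpoly"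
  assumes q: "q i = quad_form (a i)"
    and regular: "g * q i \<in> ideal_gen (q ` {..<i}) \<Longrightarrow> g \<in> ideal_gen (q ` {..<i})"
begin

lemma quadratic_regular_perturbation:
  assumes "\<And>i. P i \<in> deg_less 2"
  shows "quadratic_regular q (\<lambda>i. q i + P i)"
  by unfold_locales (use assms regular homogeneous_quad_form q in auto)

definition "qval y = (\<chi> i. eval_poly (q i) y)"

lemma qval_minus: "qval (- y) = qval y"
  by (simp add: qval_def q eval_quad_form_minus)

text \<open>A vector orthogonal to all values is a linear relation between the forms. Solved for the
  form of largest index, it puts that form into the ideal of the earlier ones, and regularity would
  put 1 there.\<close>

lemma span_qval: "span (range qval) = UNIV"
proof (rule orthogonal_trivial_imp_span, rule ccontr)
  fix w assume orth: "\<And>x. x \<in> range qval \<Longrightarrow> x \<bullet> w = 0" and "w \<noteq> 0"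
  define A where "A = {i. w $ i \<noteq> 0}"
  define k where "k = Max A"
  have "A \<noteq> {}" using \<open>w \<noteq> 0\<close> by (auto simp: A_def vec_eq_iff)
  then have k: "w $ k \<noteq> 0" using Max_in[of A] by (simp add: k_def A_def)
  have above: "w $ i = 0" if "k < i" for i
  proof (rule ccontr)
    assume "w $ i \<noteq> 0"
    then have "i \<le> k" unfolding k_def by (intro Max_ge) (simp_all add: A_def)
    then show False using that by simp
  qed
  have monom: "Const c * Var j * Var l = c *\<^sub>R (Var j * Var l)" for c and j l :: 'n
    by (simp add: Const_times_eq_scaleR)
  have comb: "(\<Sum>i\<in>UNIV. w $ i *\<^sub>R q i) = quad_form (\<lambda>j l. \<Sum>i\<in>UNIV. w $ i * a i j l)"
  proof -
    have "(\<Sum>i\<in>UNIV. w $ i *\<^sub>R q i) = (\<Sum>i\<in>UNIV. \<Sum>j\<in>UNIV. \<Sum>l\<in>UNIV. (w $ i * a i j l) *\<^sub>R (Var j * Var l))"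
      by (simp add: q quad_form_def Const_times_eq_scaleR scaleR_sum_right)
    also have "\<dots> = (\<Sum>j\<in>UNIV. \<Sum>i\<in>UNIV. \<Sum>l\<in>UNIV. (w $ i * a i j l) *\<^sub>R (Var j * Var l))"
      by (rule sum.swap)
    also have "\<dots> = (\<Sum>j\<in>UNIV. \<Sum>l\<in>UNIV. \<Sum>i\<in>UNIV. (w $ i * a i j l) *\<^sub>R (Var j * Var l))"
      by (intro sum.cong refl sum.swap)
    also have "\<dots> = quad_form (\<lambda>j l. \<Sum>i\<in>UNIV. w $ i * a i j l)"
      by (simp only: quad_form_def monom scaleR_sum_left)
    finally show ?thesis .
  qed
  have "(\<Sum>i\<in>UNIV. w $ i *\<^sub>R q i) = 0"
    unfolding comb
  proof (rule quad_form_eq_0, unfold comb[symmetric])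
    fix y
    have "qval y \<bullet> w = 0" using orth by blast
    then show "eval_poly (\<Sum>i\<in>UNIV. w $ i *\<^sub>R q i) y = 0"
      by (simp add: qval_def inner_vec_def mult.commute)
  qed
  moreover have "(\<Sum>i\<in>UNIV. w $ i *\<^sub>R q i) = (\<Sum>i\<in>insert k {..<k}. w $ i *\<^sub>R q i)"
    by (rule sum.mono_neutral_right) (use above in auto)
  ultimately have "w $ k *\<^sub>R q k = - (\<Sum>i<k. w $ i *\<^sub>R q i)" by (simp add: eq_neg_iff_add_eq_0)
  then have "q k = (1 / w $ k) *\<^sub>R - (\<Sum>i<k. w $ i *\<^sub>R q i)" using k by (metis scaleR_scaleR scaleR_one divide_self_if times_divide_eq_left mult_1)
  also have "\<dots> = (\<Sum>i<k. Const (- (w $ i) / w $ k) * q i)"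
    by (simp add: Const_times_eq_scaleR scaleR_sum_right sum_negf)
  finally have "1 * q k = (\<Sum>i<k. Const (- (w $ i) / w $ k) * q i)" by simp
  then have "1 * q k \<in> ideal_gen (q ` {..<k})"
    unfolding ideal_gen_image[OF finite]
    by (intro CollectI exI[of _ "\<lambda>i. Const (- (w $ i) / w $ k)"] conjI TrueI)
  then have "1 \<in> ideal_gen (q ` {..<k})" by (rule regular)
  then obtain h where "1 = (\<Sum>i<k. h i * q i)" by (auto simp: ideal_gen_image)
  \<comment> \<open>All forms vanish at the origin.\<close>
  then have "eval_poly 1 0 = eval_poly (\<Sum>i<k. h i * q i) 0" by simp
  then show False by (simp add: q eval_quad_form)
qed

lemma exists_independent_values: "\<exists>u. det (\<chi> j. qval (u $ j)) \<noteq> 0"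
proof -
  obtain B where B: "B \<subseteq> range qval" "independent B" "range qval \<subseteq> span B" "card B = dim (range qval)"
    by (rule basis_exists)
  have "dim (range qval) = CARD('n)"
    using span_qval by (metis DIM_cart DIM_real dim_UNIV dim_span mult.right_neutral)
  then have "card (UNIV :: 'n set) = card B" using B(4) by simp
  then obtain b :: "'n \<Rightarrow> real ^ ('n::{finite,linorder})" where b: "bij_betw b UNIV B"
    using finite_same_card_bij[OF finite independent_imp_finite[OF B(2)]] by blast
  then have "\<forall>j. \<exists>y. b j = qval y" using B(1) bij_betwE by blast
  then obtain y where y: "\<And>j. b j = qval (y j)" by metis
  have "span B = UNIV" using B(3) span_qval by (metis span_mono span_span top.extremum_uniqueI)
  have "det (\<chi> j. qval ((\<chi> j. y j) $ j)) \<noteq> 0"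
    unfolding det_nonzero_iff_rows
  proof (intro allI impI)
    fix w assume w: "\<forall>i. (\<chi> j. qval ((\<chi> j. y j) $ j)) $ i \<bullet> w = 0"
    have "B \<subseteq> {x. x \<bullet> w = 0}"
      using w y bij_betw_imp_surj_on[OF b] by auto
    moreover have "subspace {x. x \<bullet> w = 0}" by (simp add: subspace_def inner_add_left)
    ultimately have "w \<in> {x. x \<bullet> w = 0}" using \<open>span B = UNIV\<close> span_minimal by blast
    then show "w = 0" by simp
  qed
  then show ?thesis by blast
qed

text \<open>The first condition makes interpolation at 0 and the rows of \<open>e\<close> possible;
  the second yields simplicity at 0, the last at the row \<open>e $ k\<close>, whose differences to
  the other points are listed up to sign. Each condition can be met separately, hence all
  jointly.\<close>

lemma generic_points:
  obtains e where "det e \<noteq> 0" "det (\<chi> j. qval (e $ j)) \<noteq> 0"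
    "\<And>k. det (\<chi> j. qval (if j = k then e $ k else e $ j - e $ k)) \<noteq> 0"
proof -
  obtain u :: "real ^ ('n::{finite,linorder}) ^ ('n::{finite,linorder})" where u: "det (\<chi> j. qval (u $ j)) \<noteq> 0"
    using exists_independent_values by blast
  define D where "D k e = (case k of None \<Rightarrow> det (\<chi> j. qval (e $ j))
      | Some k \<Rightarrow> det (\<chi> j. qval (if j = k then e $ k else e $ j - e $ k)))" for k and e :: "real ^ ('n::{finite,linorder}) ^ ('n::{finite,linorder})"
  define f where "f k = (case k of None \<Rightarrow> det | Some k \<Rightarrow> D k)" for k
  have lin: "linear (\<lambda>e :: real ^ ('n::{finite,linorder}) ^ ('n::{finite,linorder}). e $ j)" for j
    by (rule linearI) simp_all
  have polyq: "poly_on_lines (\<lambda>e. qval (h e) $ i)" if "linear h" for h :: "real ^ ('n::{finite,linorder}) ^ ('n::{finite,linorder}) \<Rightarrow> real ^ ('n::{finite,linorder})" and i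
    using poly_on_lines_eval_poly[OF that] by (simp add: qval_def)
  have "poly_on_lines (f k)" for k
  proof (cases k)
    case None
    have "poly_on_lines (\<lambda>e :: real ^ ('n::{finite,linorder}) ^ ('n::{finite,linorder}). det e)"
      by (intro poly_on_lines_det poly_on_lines_linear linearI) simp_all
    then show ?thesis using None by (simp add: f_def)
  next
    case (Some m)
    show ?thesis
    proof (cases m)
      case None
      have "poly_on_lines (\<lambda>e :: real ^ ('n::{finite,linorder}) ^ ('n::{finite,linorder}). det (\<chi> j. qval (e $ j)))"
        using polyq[OF lin] by (intro poly_on_lines_det) simp
      then show ?thesis using Some None by (simp add: f_def D_def[abs_def])
    next
      case m: (Some l)
      have "linear (\<lambda>e :: real ^ ('n::{finite,linorder}) ^ ('n::{finite,linorder}). if j = l then e $ l else e $ j - e $ l)" for j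
        by (cases "j = l") (simp_all add: lin linear_compose_sub)
      then have "poly_on_lines (\<lambda>e :: real ^ ('n::{finite,linorder}) ^ ('n::{finite,linorder}). det (\<chi> j. qval (if j = l then e $ l else e $ j - e $ l)))"
        using polyq by (intro poly_on_lines_det) simp
      then show ?thesis using Some m by (simp add: f_def D_def[abs_def])
    qed
  qed
  moreover have "\<exists>e. f k e \<noteq> 0" for k
  proof (cases k)
    case None
    then show ?thesis by (intro exI[of _ "mat 1"]) (simp add: f_def)
  next
    case (Some m)
    show ?thesis
    proof (cases m)
      case None
      then show ?thesis using Some u by (intro exI[of _ u]) (simp add: f_def D_def)
    next
      case m: (Some l)
      \<comment> \<open>With this choice \<open>e $ j - e $ l = u $ j\<close> and
        \<open>e $ l = - u $ l\<close>; signs are invisible to quadratic forms.\<close>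
      define e where "e = (\<chi> j. if j = l then - u $ l else u $ j - u $ l)"
      have "qval (if j = l then e $ l else e $ j - e $ l) = qval (u $ j)" for j
        by (simp add: e_def qval_minus)
      then show ?thesis using Some m u by (intro exI[of _ e]) (simp add: f_def D_def)
    qed
  qed
  ultimately obtain e where e: "\<And>k. f k e \<noteq> 0"
    using poly_on_lines_common_nonzero[of UNIV f] by auto
  show ?thesis
    by (rule that[of e]) (use e[of None] e[of "Some None"] e[of "Some (Some _)"] in \<open>simp_all add: f_def D_def\<close>)
qed

text \<open>The affine part is chosen so that all of \<open>0\<close> and the generic points are zeros. Expanding the quadratic map
  at one of them expresses the values of its derivative at the differences of the points
  through the quadratic forms alone, whence all these zeros are simple.\<close>

lemma interpolating_system:
  obtains P Z where "\<And>i. P i \<in> deg_less 2" "finite Z" "card Z = CARD('n) + 1"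
    "\<And>z i. z \<in> Z \<Longrightarrow> eval_poly (q i + P i) z = 0"
    "\<And>z w. z \<in> Z \<Longrightarrow> (\<And>i. gradient (eval_poly (q i + P i)) z \<bullet> w = 0) \<Longrightarrow> w = 0"
proof -
  obtain e :: "real ^ ('n::{finite,linorder}) ^ ('n::{finite,linorder})" where e: "det e \<noteq> 0" "det (\<chi> j. qval (e $ j)) \<noteq> 0"
    "\<And>k. det (\<chi> j. qval (if j = k then e $ k else e $ j - e $ k)) \<noteq> 0"
    using generic_points by blast
  have inje: "inj (\<lambda>j. e $ j)" and inde: "independent (range (\<lambda>j. e $ j))"
    using orthogonal_trivial_imp_independent[of "\<lambda>j. e $ j"] e(1) unfolding det_nonzero_iff_rows by blast+
  \<comment> \<open>A linear correction suffices, since the forms already vanish at 0.\<close>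
  have "\<exists>L. linear L \<and> (\<forall>x\<in>range (\<lambda>j. e $ j). L x = - qval x)"
    by (rule linear_independent_extend[OF inde])
  then obtain L where L: "linear L" "\<And>j. L (e $ j) = - qval (e $ j)" by blast
  define P where "P i = (\<Sum>l\<in>UNIV. Const (L (axis l 1) $ i) * Var l)" for i
  define F where "F i = q i + P i" for i
  have P_deg: "P i \<in> deg_less 2" for i
  proof -
    have "Const c * Var l \<in> deg_less 2" for c and l :: 'n
      by (auto simp: deg_less_lookup Const_def Var_def mult_single lookup_single when_def)
    then show ?thesis unfolding P_def by (intro subspace_sum[OF subspace_deg_less])
  qed
  have evalP: "eval_poly (P i) y = L y $ i" for i y
  proof -
    have "L y = L (\<Sum>l\<in>UNIV. (y $ l) *\<^sub>R axis l 1)"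
      using basis_expansion[of y] by (simp add: scalar_mult_eq_scaleR)
    then show ?thesis
      by (simp add: P_def linear_sum[OF L(1)] linear_scale[OF L(1)] mult.commute)
  qed
  have gradP: "gradient (eval_poly (P i)) y \<bullet> z = eval_poly (P i) z" for i y z
    unfolding P_def gradient_eval_sum inner_sum_left gradient_eval_mult gradient_eval_Var gradient_eval_Const
    by (simp add: inner_axis')
  define DF where "DF y z = (\<chi> i. gradient (eval_poly (F i)) y \<bullet> z)" for y z
  define Fv where "Fv y = (\<chi> i. eval_poly (F i) y)" for y
  have Fv: "Fv y = qval y + L y" for y
    by (simp add: Fv_def F_def qval_def evalP vec_eq_iff)
  have expand: "Fv (y + z) = Fv y + DF y z + qval z" for y z
  proof -
    have "eval_poly (F i) (y + z) = eval_poly (F i) y + gradient (eval_poly (F i)) y \<bullet> z + eval_poly (q i) z" for i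
      unfolding F_def gradient_eval_add inner_add_left gradP
      by (simp add: q eval_quad_form_plus evalP linear_add[OF L(1)])
    then show ?thesis by (simp add: Fv_def DF_def qval_def vec_eq_iff)
  qed
  have linDF: "linear (DF y)" for y
    by (rule linearI) (simp_all add: DF_def inner_add_right vec_eq_iff)
  have qval0: "qval 0 = 0" by (simp add: qval_def q eval_quad_form vec_eq_iff)
  have Fv0: "Fv 0 = 0" by (simp add: Fv qval0 linear_0[OF L(1)])
  have Fve: "Fv (e $ j) = 0" for j by (simp add: Fv L(2))
  \<comment> \<open>If the derivative reaches the negatives of independent vectors
    \<open>qval (r j)\<close>, it is onto, hence injective.\<close>
  have injDF: "inj (DF y)" if rows: "det (\<chi> j. qval (r j)) \<noteq> 0" and r: "\<And>j. - qval (r j) \<in> range (DF y)" for y and r :: "'n \<Rightarrow> real ^ ('n::{finite,linorder})"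
  proof -
    have "span (range (DF y)) = UNIV"
    proof (rule orthogonal_trivial_imp_span)
      fix w assume w: "\<And>x. x \<in> range (DF y) \<Longrightarrow> x \<bullet> w = 0"
      have "qval (r j) \<bullet> w = 0" for j using w[OF r[of j]] by simp
      then show "w = 0" using rows unfolding det_nonzero_iff_rows by simp
    qed
    then have "surj (DF y)"
      using linear_subspace_image[OF linDF subspace_UNIV, of y] by (metis span_eq_iff)
    then show "inj (DF y)" by (metis linear_surjective_imp_injective linDF)
  qed
  define Z where "Z = insert 0 (range (\<lambda>j. e $ j))"
  have zero: "Fv z = 0" if "z \<in> Z" for z using that Fv0 Fve by (auto simp: Z_def)
  have simple: "inj (DF z)" if "z \<in> Z" for z
  proof -
    from that consider "z = 0" | k where "z = e $ k" by (auto simp: Z_def)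
    then show ?thesis
    proof cases
      case 1
      show ?thesis
      proof (rule injDF[OF e(2)])
        fix j
        have "DF z (e $ j) = - qval (e $ j)"
          using expand[of 0 "e $ j"] Fv0 Fve 1 by (simp add: eq_neg_iff_add_eq_0)
        then show "- qval (e $ j) \<in> range (DF z)" by (metis rangeI)
      qed
    next
      case (2 k)
      show ?thesis
      proof (rule injDF[OF e(3)[of k]])
        fix j
        \<comment> \<open>The difference from \<open>z\<close> to another zero: to the origin for
          \<open>j = k\<close>, to \<open>e $ j\<close> otherwise.\<close>
        define x where "x = (if j = k then - e $ k else e $ j - e $ k)"
        have "Fv (z + x) = 0" using Fv0 Fve 2 by (simp add: x_def)
        then have "DF z x = - qval x"
          using expand[of z x] Fve 2 by (simp add: eq_neg_iff_add_eq_0)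
        moreover have "qval x = qval (if j = k then e $ k else e $ j - e $ k)"
          by (simp add: x_def qval_minus)
        ultimately show "- qval (if j = k then e $ k else e $ j - e $ k) \<in> range (DF z)" by (metis rangeI)
      qed
    qed
  qed
  show ?thesis
  proof (rule that[of P Z])
    show "P i \<in> deg_less 2" for i by (rule P_deg)
    show "finite Z" by (simp add: Z_def)
    have "0 \<notin> range (\<lambda>j. e $ j)" using inde dependent_zero by metis
    then show "card Z = CARD('n) + 1" by (simp add: Z_def card_image[OF inje])
    show "eval_poly (q i + P i) z = 0" if "z \<in> Z" for z i
    proof -
      have "Fv z $ i = 0" using zero[OF that] by simp
      then show ?thesis by (simp add: Fv_def F_def)
    qed
    show "w = 0" if "z \<in> Z" "\<And>i. gradient (eval_poly (q i + P i)) z \<bullet> w = 0" for z w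
    proof -
      have "DF z w = DF z 0"
        using that(2) by (simp add: DF_def F_def vec_eq_iff)
      then show ?thesis using simple[OF that(1)] by (simp add: inj_eq)
    qed
  qed
qed

lemma many_single_zeros:
  obtains P where "\<And>i. P i \<in> deg_less 2"
    "enat (CARD('n) + 1 + (if even CARD('n) then 1 else 0)) \<le> ecard (single_zeros (\<lambda>i. q i + P i))"
proof -
  obtain P Z where P: "\<And>i. P i \<in> deg_less 2" and Z: "finite Z" "card Z = CARD('n) + 1"
    "\<And>z i. z \<in> Z \<Longrightarrow> eval_poly (q i + P i) z = 0"
    "\<And>z w. z \<in> Z \<Longrightarrow> (\<And>i. gradient (eval_poly (q i + P i)) z \<bullet> w = 0) \<Longrightarrow> w = 0"
    using interpolating_system by blast
  define f where "f y = (\<chi> i. eval_poly (q i + P i) y)" for y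
  define f' where "f' y h = (\<chi> i. gradient (eval_poly (q i + P i)) y \<bullet> h)" for y h
  have der: "(f has_derivative f' y) (at y)" for y
    using has_derivative_vec_eval[of "\<lambda>i. q i + P i" y] unfolding f_def f'_def .
  have inj_iff: "inj (f' y) \<longleftrightarrow> (\<forall>w. (\<forall>i. gradient (eval_poly (q i + P i)) y \<bullet> w = 0) \<longrightarrow> w = 0)" for y
    unfolding linear_inj_iff_eq_0[OF has_derivative_linear[OF der]]
    by (simp add: f'_def vec_eq_iff)
  have fZ: "f z = 0" if "z \<in> Z" for z
    using Z(3)[OF that] by (auto simp: f_def vec_eq_iff)
  have injZ: "inj (f' z)" if "z \<in> Z" for z
    using Z(4)[OF that] unfolding inj_iff by blast
  obtain v W where W: "\<And>w. w \<in> W \<Longrightarrow> f w = v" "finite W" "card W = card Z"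
    "\<And>y. f y = v \<Longrightarrow> inj (f' y)"
    using regular_value_perturbation[OF der Z(1) fZ injZ] by metis
  \<comment> \<open>Shifting the constants turns the fibre over \<open>v\<close> into the zero set
    and leaves the gradients unchanged.\<close>
  define P' where "P' i = P i + Const (- (v $ i))" for i
  have P': "P' i \<in> deg_less 2" for i
    unfolding P'_def
    by (rule subspace_add[OF subspace_deg_less P]) (simp add: deg_less_lookup Const_def lookup_single when_def)
  interpret quadratic_regular q "\<lambda>i. q i + P' i"
    by (rule quadratic_regular_perturbation[OF P'])
  have grad: "gradient (eval_poly (q i + P' i)) y = gradient (eval_poly (q i + P i)) y" for i y
    unfolding P'_def gradient_eval_add gradient_eval_Const by simp
  have zeros: "(\<forall>i. eval_poly (q i + P' i) y = 0) \<longleftrightarrow> f y = v" for y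
    by (simp add: P'_def f_def vec_eq_iff algebra_simps)
  have simple: "w = 0" if "\<And>i. eval_poly (q i + P' i) z = 0" "\<And>i. gradient (eval_poly (q i + P' i)) z \<bullet> w = 0" for z w
    using W(4)[of z] that zeros[of z] unfolding grad inj_iff by blast
  have single: "single_zeros (\<lambda>i. q i + P' i) = {y. \<forall>i. eval_poly (q i + P' i) y = 0}"
  proof (intro antisym subsetI)
    fix y assume "y \<in> {y. \<forall>i. eval_poly (q i + P' i) y = 0}"
    then show "y \<in> single_zeros (\<lambda>i. q i + P' i)"
      using simple by (intro in_single_zerosI) blast+
  qed (simp add: single_zeros_def)
  have "W \<subseteq> {y. \<forall>i. eval_poly (q i + P' i) y = 0}" using W(1) zeros by blast
  from card_mono[OF finite_zeros this] have "CARD('n) + 1 \<le> card {y. \<forall>i. eval_poly (q i + P' i) y = 0}"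
    unfolding W(3) Z(2) .
  moreover have "even (card {y. \<forall>i. eval_poly (q i + P' i) y = 0})"
    by (rule even_card_zeros) (rule simple)
  \<comment> \<open>For even d the count is even and at least the odd number d + 1, hence at least d
    + 2.\<close>
  ultimately have "CARD('n) + 1 + (if even CARD('n) then 1 else 0) \<le> card {y. \<forall>i. eval_poly (q i + P' i) y = 0}"
    by (cases "card {y. \<forall>i. eval_poly (q i + P' i) y = 0} = CARD('n) + 1") auto
  then have "enat (CARD('n) + 1 + (if even CARD('n) then 1 else 0)) \<le> ecard (single_zeros (\<lambda>i. q i + P' i))"
    unfolding single ecard_def using finite_zeros by simp
  with P' show ?thesis by (rule that)
qed

end

theorem theorem2p19:
  fixes c :: "(real ^ 'n::{finite, linorder}) \<times> (real ^ 'n::{finite, linorder}) \<Rightarrow> real"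
    and x0 :: "real ^ 'n::{finite, linorder}"
  assumes "second_order_complete_at_infinity c x0"
    and "C12_at c (x0, x0)"
  shows "enat (CARD('n) + 1 + (if even CARD('n) then 1 else 0)) \<le> Nc c x0 \<and>
         Nc c x0 \<le> enat (2 ^ CARD('n))"
proof -
  define a where "a i j l = iter_partial [Inl i, Inr j, Inr l] c (x0, x0)" for i j l
  have Hc: "Hc c x0 i = quad_form (a i)" for i
    by (simp only: Hc_def quad_form_def a_def)
  \<comment> \<open>Completeness speaks of leading forms; the entries of \<open>Hc\<close> are their
    own, even when zero.\<close>
  have "hom_part (Hc c x0 i) = Hc c x0 i" for i
    unfolding Hc by (rule hom_part_homogeneous[OF homogeneous_quad_form])
  then interpret regular_quadratic_forms a "Hc c x0"
    using assms(1) unfolding second_order_complete_at_infinity_def complete_at_infinity_def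
    by unfold_locales (use Hc in auto)
  have deg: "(\<forall>i. total_degree (P i) \<le> 1) \<longleftrightarrow> (\<forall>i. P i \<in> deg_less 2)" for P :: "'n \<Rightarrow> 'n rpoly"
    unfolding total_degree_le_iff by (simp add: numeral_2_eq_2)
  show ?thesis
  proof
    obtain P where P: "\<And>i. P i \<in> deg_less 2"
      "enat (CARD('n) + 1 + (if even CARD('n) then 1 else 0)) \<le> ecard (single_zeros (\<lambda>i. Hc c x0 i + P i))"
      using many_single_zeros by blast
    note P(2)
    also have "ecard (single_zeros (\<lambda>i. Hc c x0 i + P i)) \<le> Nc c x0"
      unfolding Nc_def deg by (rule SUP_upper) (use P(1) in simp)
    finally show "enat (CARD('n) + 1 + (if even CARD('n) then 1 else 0)) \<le> Nc c x0" .
    show "Nc c x0 \<le> enat (2 ^ CARD('n))"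
      unfolding Nc_def deg
    proof (rule SUP_least)
      fix P :: "'n \<Rightarrow> 'n rpoly" assume "P \<in> {P. \<forall>i. P i \<in> deg_less 2}"
      then interpret quadratic_regular "Hc c x0" "\<lambda>i. Hc c x0 i + P i"
        by (intro quadratic_regular_perturbation) simp
      show "ecard (single_zeros (\<lambda>i. Hc c x0 i + P i)) \<le> enat (2 ^ CARD('n))"
        by (rule ecard_single_zeros_le)
    qed
  qed
qed

end
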